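(* Let $(M,\omega)$ be a symplectic manifold and $X\subseteq M$ a closed subset. If $X$ is a connected isotropic submanifold of $M$, then $\Vert H\Vert_X=0$ for every $H\in\mathcal{H}(M,\omega,X)$.
   Context: All manifolds are smooth with empty boundary. For a time-dependent vector field $V:[0,1]\times M\to TM$ let $\mathcal{D}_V^t$ be the set of $x_0\in M$ for which $\dot x(s)=V(s,x(s))$, $x(0)=x_0$ has a solution $x\in C^\infty([0,t],M)$, and put $\varphi_V^t(x_0):=x(t)$ on $\mathcal{D}_V^t$. For $H\in C^\infty([0,1]\times M,\mathbb{R})$, $H^t:=H(t,\cdot)$, the Hamiltonian vector field is given by $\omega(X_{H^t},\cdot)=dH^t$. $V$ is called $X$-compatible iff $X\subseteq\mathcal{D}_V^1$ and $\varphi_V^t(X)=X$ for every $t\in[0,1]$. $\mathcal{H}(M,\omega,X)$ is the set of all $H\in C^\infty([0,1]\times M,\mathbb{R})$ such that $X_H$ is $X$-compatible. The Hofer norm of $H$ on $X$ is $\Vert H\Vert_X:=\int_0^1\big(\sup_X H^t-\inf_X H^t\big)dt\in[0,\infty]$. Isotropic means that the pullback of $\omega$ to $X$ vanishes. *)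

theory Defs
  imports "HOL-Analysis.Analysis"
begin

section \<open>Smooth maps between normed spaces\<close>

text \<open>Intended for open \<open>S\<close> in a finite-dimensional space, where it suffices to iterate
  directional derivatives.\<close>

primrec Ck_on :: "nat \<Rightarrow> 'a::real_normed_vector set \<Rightarrow> ('a \<Rightarrow> 'b::real_normed_vector) \<Rightarrow> bool" where
  "Ck_on 0 S f \<longleftrightarrow> continuous_on S f"
| "Ck_on (Suc k) S f \<longleftrightarrow> (\<forall>x\<in>S. f differentiable (at x)) \<and>
     (\<forall>v. Ck_on k S (\<lambda>x. frechet_derivative f (at x) v))"

text \<open>Smoothness on an arbitrary subset means local extendability to a smooth map on an open set.
  On open sets this is ordinary smoothness; on \<open>{0..t}\<close> and \<open>{0..1} \<times> V\<close> it is smoothness up to the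
  boundary.\<close>

definition smooth_on :: "'a::real_normed_vector set \<Rightarrow> ('a \<Rightarrow> 'b::real_normed_vector) \<Rightarrow> bool" where
  "smooth_on S f \<longleftrightarrow> (\<forall>x\<in>S. \<exists>W g. open W \<and> x \<in> W \<and> (\<forall>k. Ck_on k W g) \<and> (\<forall>y\<in>S \<inter> W. g y = f y))"


section \<open>Smooth manifolds\<close>

text \<open>A chart is a pair of a domain and a coordinate map; the values of the coordinate map outside
  the domain are irrelevant.\<close>

type_synonym ('m, 'e) chart = "'m set \<times> ('m \<Rightarrow> 'e)"

abbreviation dom_of :: "('m, 'e) chart \<Rightarrow> 'm set" where
  "dom_of c \<equiv> fst c"

abbreviation coord :: "('m, 'e) chart \<Rightarrow> 'm \<Rightarrow> 'e" where
  "coord c \<equiv> snd c"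

abbreviation param :: "('m, 'e) chart \<Rightarrow> 'e \<Rightarrow> 'm" where
  "param c \<equiv> inv_into (dom_of c) (coord c)"

abbreviation cod_of :: "('m, 'e) chart \<Rightarrow> 'e set" where
  "cod_of c \<equiv> coord c ` dom_of c"

definition is_chart :: "('m::topological_space, 'e::real_inner) chart \<Rightarrow> bool" where
  "is_chart c \<longleftrightarrow> open (dom_of c) \<and> open (cod_of c) \<and>
     homeomorphism (dom_of c) (cod_of c) (coord c) (param c)"

definition smooth_transition :: "('m, 'e::real_inner) chart \<Rightarrow> ('m, 'e) chart \<Rightarrow> bool" where
  "smooth_transition c d \<longleftrightarrow> smooth_on (coord c ` (dom_of c \<inter> dom_of d)) (coord d \<circ> param c)"

text \<open>A maximal smooth atlas on the Hausdorff, second countable space \<open>'m\<close>. The model space is a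
  finite-dimensional inner product space rather than a type of class \<open>euclidean_space\<close> because the
  latter class excludes dimension 0.\<close>

definition smooth_manifold ::
    "('m::{t2_space,second_countable_topology}, 'e::real_inner) chart set \<Rightarrow> bool" where
  "smooth_manifold A \<longleftrightarrow>
     (\<exists>B. finite B \<and> span B = (UNIV :: 'e set)) \<and>
     (\<forall>c\<in>A. is_chart c) \<and>
     (\<Union>c\<in>A. dom_of c) = UNIV \<and>
     (\<forall>c\<in>A. \<forall>d\<in>A. smooth_transition c d) \<and>
     (\<forall>c. is_chart c \<and> (\<forall>d\<in>A. smooth_transition c d \<and> smooth_transition d c) \<longrightarrow> c \<in> A)"


section \<open>Tangent vectors and differentials\<close>

text \<open>A tangent vector at \<open>p\<close> assigns to every chart around \<open>p\<close> a coordinate vector, these being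
  related by the derivatives of the transition maps. Off the charts around \<open>p\<close> the value is 0, so
  that tangent vectors are determined by their coordinates.\<close>

type_synonym ('m, 'e) tangent_vector = "('m, 'e) chart \<Rightarrow> 'e"

definition charts_at :: "('m, 'e) chart set \<Rightarrow> 'm \<Rightarrow> ('m, 'e) chart set" where
  "charts_at A p = {c \<in> A. p \<in> dom_of c}"

definition tangent_space ::
    "('m, 'e::real_inner) chart set \<Rightarrow> 'm \<Rightarrow> ('m, 'e) tangent_vector set" where
  "tangent_space A p =
     {v. (\<forall>c. c \<notin> charts_at A p \<longrightarrow> v c = 0) \<and>
         (\<forall>c\<in>charts_at A p. \<forall>d\<in>charts_at A p.
            v d = frechet_derivative (coord d \<circ> param c) (at (coord c p)) (v c))}"

text \<open>The tangent vector at \<open>p\<close> whose coordinates in the chart \<open>c\<close> are \<open>a\<close>.\<close>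

definition coord_vector ::
    "('m, 'e::real_inner) chart set \<Rightarrow> ('m, 'e) chart \<Rightarrow> 'm \<Rightarrow> 'e \<Rightarrow> ('m, 'e) tangent_vector" where
  "coord_vector A c p a = (\<lambda>d. if d \<in> charts_at A p
     then frechet_derivative (coord d \<circ> param c) (at (coord c p)) a else 0)"

definition differential ::
    "('m, 'e::real_inner) chart set \<Rightarrow> ('m \<Rightarrow> real) \<Rightarrow> 'm \<Rightarrow> ('m, 'e) tangent_vector \<Rightarrow> real" where
  "differential A f p v = (THE r. \<forall>c\<in>charts_at A p.
     r = frechet_derivative (f \<circ> param c) (at (coord c p)) (v c))"


section \<open>Symplectic forms\<close>

type_synonym ('m, 'e) two_form =
  "'m \<Rightarrow> ('m, 'e) tangent_vector \<Rightarrow> ('m, 'e) tangent_vector \<Rightarrow> real"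

definition form_coord ::
    "('m, 'e::real_inner) chart set \<Rightarrow> ('m, 'e) two_form \<Rightarrow> ('m, 'e) chart \<Rightarrow> 'e \<Rightarrow> 'e \<Rightarrow> 'e \<Rightarrow> real" where
  "form_coord A \<omega> c a b y =
     \<omega> (param c y) (coord_vector A c (param c y) a) (coord_vector A c (param c y) b)"

definition smooth_two_form ::
    "('m, 'e::real_inner) chart set \<Rightarrow> ('m, 'e) two_form \<Rightarrow> bool" where
  "smooth_two_form A \<omega> \<longleftrightarrow>
     (\<forall>p. \<forall>u\<in>tangent_space A p. \<forall>v\<in>tangent_space A p.
        \<omega> p u v = - \<omega> p v u) \<and>
     (\<forall>p. \<forall>u\<in>tangent_space A p. \<forall>v\<in>tangent_space A p. \<forall>w\<in>tangent_space A p. \<forall>r s.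
        \<omega> p (\<lambda>c. r *\<^sub>R u c + s *\<^sub>R v c) w = r * \<omega> p u w + s * \<omega> p v w) \<and>
     (\<forall>c\<in>A. \<forall>a b. smooth_on (cod_of c) (form_coord A \<omega> c a b))"

text \<open>In a chart, \<open>d\<omega>(X,Y,Z) = X \<omega>(Y,Z) + Y \<omega>(Z,X) + Z \<omega>(X,Y)\<close> for constant coordinate vector
  fields \<open>X, Y, Z\<close>, since their brackets vanish.\<close>

definition closed_two_form ::
    "('m, 'e::real_inner) chart set \<Rightarrow> ('m, 'e) two_form \<Rightarrow> bool" where
  "closed_two_form A \<omega> \<longleftrightarrow> (\<forall>c\<in>A. \<forall>y\<in>cod_of c. \<forall>a b e.
     frechet_derivative (form_coord A \<omega> c b e) (at y) a +
     frechet_derivative (form_coord A \<omega> c e a) (at y) b +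
     frechet_derivative (form_coord A \<omega> c a b) (at y) e = 0)"

definition nondegenerate ::
    "('m, 'e::real_inner) chart set \<Rightarrow> ('m, 'e) two_form \<Rightarrow> bool" where
  "nondegenerate A \<omega> \<longleftrightarrow> (\<forall>p. \<forall>u\<in>tangent_space A p.
     (\<forall>w\<in>tangent_space A p. \<omega> p u w = 0) \<longrightarrow> u = (\<lambda>_. 0))"

definition symplectic_manifold ::
    "('m::{t2_space,second_countable_topology}, 'e::real_inner) chart set \<Rightarrow> ('m, 'e) two_form \<Rightarrow> bool"
  where
  "symplectic_manifold A \<omega> \<longleftrightarrow>
     smooth_manifold A \<and> smooth_two_form A \<omega> \<and> closed_two_form A \<omega> \<and> nondegenerate A \<omega>"


section \<open>Submanifolds\<close>

definition slice_chart ::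
    "('m, 'e::real_inner) chart set \<Rightarrow> 'm set \<Rightarrow> ('m, 'e) chart \<Rightarrow> 'e set \<Rightarrow> bool" where
  "slice_chart A X c S \<longleftrightarrow>
     c \<in> A \<and> subspace S \<and> coord c ` (dom_of c \<inter> X) = cod_of c \<inter> S"

definition submanifold :: "('m, 'e::real_inner) chart set \<Rightarrow> 'm set \<Rightarrow> bool" where
  "submanifold A X \<longleftrightarrow>
     (\<exists>k. \<forall>p\<in>X. \<exists>c S. slice_chart A X c S \<and> p \<in> dom_of c \<and> dim S = k)"

definition submanifold_tangent_space ::
    "('m, 'e::real_inner) chart set \<Rightarrow> 'm set \<Rightarrow> 'm \<Rightarrow> ('m, 'e) tangent_vector set" where
  "submanifold_tangent_space A X p =
     {v \<in> tangent_space A p. \<exists>c S. slice_chart A X c S \<and> p \<in> dom_of c \<and> v c \<in> S}"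

definition isotropic ::
    "('m, 'e::real_inner) chart set \<Rightarrow> ('m, 'e) two_form \<Rightarrow> 'm set \<Rightarrow> bool" where
  "isotropic A \<omega> X \<longleftrightarrow> (\<forall>p\<in>X. \<forall>u\<in>submanifold_tangent_space A X p.
     \<forall>v\<in>submanifold_tangent_space A X p. \<omega> p u v = 0)"


section \<open>Flows of time-dependent vector fields\<close>

type_synonym ('m, 'e) time_vector_field = "real \<Rightarrow> 'm \<Rightarrow> ('m, 'e) tangent_vector"

definition smooth_curve ::
    "('m::topological_space, 'e::real_inner) chart set \<Rightarrow> real \<Rightarrow> (real \<Rightarrow> 'm) \<Rightarrow> bool" where
  "smooth_curve A t x \<longleftrightarrow> continuous_on {0..t} x \<and>
     (\<forall>c\<in>A. smooth_on {s \<in> {0..t}. x s \<in> dom_of c} (coord c \<circ> x))"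

definition is_solution ::
    "('m::topological_space, 'e::real_inner) chart set \<Rightarrow> ('m, 'e) time_vector_field \<Rightarrow>
     real \<Rightarrow> 'm \<Rightarrow> (real \<Rightarrow> 'm) \<Rightarrow> bool" where
  "is_solution A V t x0 x \<longleftrightarrow> smooth_curve A t x \<and> x 0 = x0 \<and>
     (\<forall>s\<in>{0..t}. \<forall>c\<in>charts_at A (x s).
        ((coord c \<circ> x) has_vector_derivative V s (x s) c) (at s within {0..t}))"

definition flow_domain ::
    "('m::topological_space, 'e::real_inner) chart set \<Rightarrow> ('m, 'e) time_vector_field \<Rightarrow>
     real \<Rightarrow> 'm set" where
  "flow_domain A V t = {x0. \<exists>x. is_solution A V t x0 x}"

definition flow ::
    "('m::topological_space, 'e::real_inner) chart set \<Rightarrow> ('m, 'e) time_vector_field \<Rightarrow>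
     real \<Rightarrow> 'm \<Rightarrow> 'm" where
  "flow A V t x0 = (THE y. \<exists>x. is_solution A V t x0 x \<and> y = x t)"

definition compatible ::
    "('m::topological_space, 'e::real_inner) chart set \<Rightarrow> 'm set \<Rightarrow> ('m, 'e) time_vector_field \<Rightarrow>
     bool" where
  "compatible A X V \<longleftrightarrow> X \<subseteq> flow_domain A V 1 \<and> (\<forall>t\<in>{0..1}. flow A V t ` X = X)"


section \<open>Hamiltonian functions and the Hofer norm\<close>

text \<open>Elements of \<open>C\<^sup>\<infinity>([0,1] \<times> M, \<real>)\<close> are represented by curried functions whose values at times
  outside \<open>[0,1]\<close> are irrelevant.\<close>

definition smooth_time_function ::
    "('m, 'e::real_inner) chart set \<Rightarrow> (real \<Rightarrow> 'm \<Rightarrow> real) \<Rightarrow> bool" where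
  "smooth_time_function A H \<longleftrightarrow>
     (\<forall>c\<in>A. smooth_on ({0..1} \<times> cod_of c) (\<lambda>(t, y). H t (param c y)))"

definition hamiltonian_vector_field ::
    "('m, 'e::real_inner) chart set \<Rightarrow> ('m, 'e) two_form \<Rightarrow> ('m \<Rightarrow> real) \<Rightarrow>
     'm \<Rightarrow> ('m, 'e) tangent_vector" where
  "hamiltonian_vector_field A \<omega> f p =
     (THE u. u \<in> tangent_space A p \<and> (\<forall>w\<in>tangent_space A p. \<omega> p u w = differential A f p w))"

definition compatible_hamiltonians ::
    "('m::topological_space, 'e::real_inner) chart set \<Rightarrow> ('m, 'e) two_form \<Rightarrow> 'm set \<Rightarrow>
     (real \<Rightarrow> 'm \<Rightarrow> real) set" where
  "compatible_hamiltonians A \<omega> X =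
     {H. smooth_time_function A H \<and> compatible A X (\<lambda>t. hamiltonian_vector_field A \<omega> (H t))}"

text \<open>For empty \<open>X\<close> the integrand is \<open>e2ennreal (-\<infinity>) = 0\<close>.\<close>

definition hofer_norm :: "'m set \<Rightarrow> (real \<Rightarrow> 'm \<Rightarrow> real) \<Rightarrow> ennreal" where
  "hofer_norm X H =
     (\<integral>\<^sup>+ t\<in>{0..1}. e2ennreal ((SUP x\<in>X. ereal (H t x)) - (INF x\<in>X. ereal (H t x))) \<partial>lborel)"

end

theory Submission
  imports Defs
begin

text \<open>Every \<open>p \<in> X\<close> lies at time \<open>t\<close> on an integral curve of \<open>X\<^sub>H\<close> that stays in \<open>X\<close>, because the flow
  maps \<open>X\<close> onto itself. Hence \<open>X\<^sub>H\<^sub>t(p)\<close> is tangent to \<open>X\<close>, and \<open>dH\<^sub>t = \<omega>(X\<^sub>H\<^sub>t, \<cdot>)\<close> vanishes on \<open>T\<^sub>pX\<close> by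
  isotropy, so \<open>H\<^sub>t\<close> is constant on the connected set \<open>X\<close>. The flow is a definite description, so
  that it only agrees with the integral curves once these are known to be unique; this rests on \<open>X\<^sub>H\<close>
  being locally Lipschitz in charts.\<close>

section \<open>Finite-dimensional inner product spaces\<close>

text \<open>The obstacle is that \<open>flow\<close>, \<open>hamiltonian_vector_field\<close> and
  \<open>differential\<close> are definite descriptions, which say nothing until existence and
  uniqueness are proved. For the field, nondegeneracy makes
  \<open>u \<mapsto> \<omega>(u, \<cdot>)\<close> injective, and finite dimension makes it
  surjective. For the flow, the field has no explicit formula in coordinates, only a linear system
  with smooth coefficients. The Lipschitz estimate is therefore extracted from the system itself:
  near a point the form stays uniformly invertible, and both sides of the system are Lipschitz. At
  times 0 and 1 the Hamiltonian is smooth only up to the boundary, so the estimates are made for a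
  smooth extension to an open set of space-time, and curves are differentiated within the time
  interval. Tangency at the end times thus has to come from a one-sided derivative; this suffices
  because slice charts turn curves in \<open>X\<close> into curves in a linear subspace.\<close>

definition onb_of :: "'a::real_inner set \<Rightarrow> 'a set \<Rightarrow> bool" where
  "onb_of S B \<longleftrightarrow> finite B \<and> span B = S \<and> (\<forall>a\<in>B. \<forall>b\<in>B. a \<bullet> b = of_bool (a = b))"

text \<open>Gram-Schmidt on a maximal independent subset of \<open>S\<close>, which is finite
  because \<open>C\<close> spans the whole space. The case \<open>S = UNIV\<close> serves the norm
  estimates, general \<open>S\<close> the slice charts. An empty basis is allowed, so dimension 0 is
  no special case.\<close>

lemma onb_of_exists:
  fixes S :: "'a::real_inner set"
  assumes "finite C" "span C = (UNIV :: 'a set)" "subspace S"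
  obtains B where "onb_of S B"
proof -
  obtain D where D: "D \<subseteq> S" "independent D" "S \<subseteq> span D"
    using real_vector.maximal_independent_subset by blast
  have "finite D"
    using real_vector.independent_span_bound[OF assms(1) D(2)] assms(2) by auto
  then obtain E where E: "finite E" "span E = span D" "pairwise orthogonal E"
    using basis_orthogonal by blast
  have "span D = S"
    using D assms(3) by (simp add: real_vector.span_subspace)
  \<comment> \<open>\<open>E\<close> is orthogonal but may contain 0, which has to be dropped before
    normalising.\<close>
  define B where "B = (\<lambda>x. x /\<^sub>R norm x) ` (E - {0})"
  have "span B = span E"
  proof
    show "span B \<subseteq> span E"
      by (rule span_minimal) (auto simp: B_def span_base span_scale)
    have "x \<in> span B" if "x \<in> E" for x
    proof (cases "x = 0")
      case False
      then have "x /\<^sub>R norm x \<in> span B"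
        using that by (auto simp: B_def intro: span_base)
      from span_scale[OF this, of "norm x"] show ?thesis
        using False by simp
    qed (simp add: span_zero)
    then show "span E \<subseteq> span B"
      by (intro span_minimal) auto
  qed
  moreover have "a \<bullet> b = of_bool (a = b)" if ab: "a \<in> B" "b \<in> B" for a b
  proof -
    obtain x y where xy: "x \<in> E" "y \<in> E" "x \<noteq> 0" "y \<noteq> 0" "a = x /\<^sub>R norm x" "b = y /\<^sub>R norm y"
      using ab by (auto simp: B_def)
    have aa: "a \<bullet> a = 1"
      using xy by (simp add: dot_square_norm power2_eq_square)
    show ?thesis
    proof (cases "x = y")
      case True
      then show ?thesis using xy aa by simp
    next
      case False
      then have "x \<bullet> y = 0"
        using E(3) xy by (auto simp: pairwise_def orthogonal_def)
      then have "a \<bullet> b = 0" using xy by simp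
      then show ?thesis using aa by auto
    qed
  qed
  ultimately have "onb_of S B"
    using E \<open>span D = S\<close> by (auto simp: onb_of_def B_def)
  then show thesis by (rule that)
qed

lemma onb_of_expansion:
  assumes "onb_of S B" "x \<in> S"
  shows "(\<Sum>b\<in>B. (x \<bullet> b) *\<^sub>R b) = x"
proof -
  have "x \<in> span B" using assms by (simp add: onb_of_def)
  then obtain r where r: "x = (\<Sum>a\<in>B. r a *\<^sub>R a)"
    using assms real_vector.span_finite[of B] by (auto simp: onb_of_def)
  have "x \<bullet> b = r b" if "b \<in> B" for b
  proof -
    have "x \<bullet> b = (\<Sum>a\<in>B. r a * (a \<bullet> b))"
      by (simp add: r inner_sum_left)
    also have "\<dots> = (\<Sum>a\<in>B. if a = b then r a else 0)"
      using assms that by (intro sum.cong) (auto simp: onb_of_def)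
    finally show ?thesis
      using assms that by (simp add: onb_of_def)
  qed
  then show ?thesis by (simp add: r)
qed

lemma onb_of_norm: "onb_of S B \<Longrightarrow> b \<in> B \<Longrightarrow> norm b = 1"
  by (simp add: onb_of_def norm_eq_sqrt_inner)

lemma onb_of_inner_le: "onb_of S B \<Longrightarrow> b \<in> B \<Longrightarrow> \<bar>x \<bullet> b\<bar> \<le> norm x"
  using Cauchy_Schwarz_ineq2[of x b] onb_of_norm by fastforce

lemma onb_of_linear_expansion:
  assumes "onb_of UNIV B" "linear f"
  shows "f x = (\<Sum>b\<in>B. (x \<bullet> b) *\<^sub>R f b)"
proof -
  have "f x = f (\<Sum>b\<in>B. (x \<bullet> b) *\<^sub>R b)"
    using onb_of_expansion[OF assms(1), of x] by simp
  then show ?thesis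
    by (simp add: linear_sum[OF assms(2)] linear_scale[OF assms(2)])
qed

text \<open>Triangle inequality in the basis expansion. The constant is crude, but it depends only
  on the values of \<open>f\<close> on the basis, so it varies continuously whenever those values
  do.\<close>

lemma onb_of_linear_bound:
  fixes f :: "'a::real_inner \<Rightarrow> 'b::real_normed_vector"
  assumes "onb_of UNIV B" "linear f"
  shows "norm (f x) \<le> (\<Sum>b\<in>B. norm (f b)) * norm x"
proof -
  have "norm (f x) \<le> (\<Sum>b\<in>B. norm ((x \<bullet> b) *\<^sub>R f b))"
    by (subst onb_of_linear_expansion[OF assms]) (rule norm_sum)
  also have "\<dots> \<le> (\<Sum>b\<in>B. norm (f b) * norm x)"
    using onb_of_inner_le[OF assms(1)]
    by (intro sum_mono) (auto simp: mult.commute[of "norm (f _)"] intro!: mult_right_mono)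
  finally show ?thesis by (simp add: sum_distrib_right)
qed

text \<open>Dimension count: an injective \<open>f\<close> carries a basis to an independent set of
  the same size, and a vector outside the span of that set would enlarge it beyond the exchange
  bound.\<close>

lemma linear_inj_imp_surj_finite_span:
  fixes f :: "'a::real_vector \<Rightarrow> 'a"
  assumes "finite C" "span C = (UNIV :: 'a set)" "linear f" "inj f"
  shows "surj f"
proof -
  obtain D where D: "independent D" "span D = (UNIV :: 'a set)"
    using real_vector.maximal_independent_subset[of UNIV] by (metis top.extremum_unique)
  have fD: "finite D"
    using real_vector.independent_span_bound[OF assms(1) D(1)] assms(2) by auto
  have ind: "independent (f ` D)"
    by (rule linear_independent_injective_image[OF assms(3) D(1)])
       (rule inj_on_subset[OF assms(4) subset_UNIV])
  have "v \<in> span (f ` D)" for v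
  proof (rule ccontr)
    assume v: "v \<notin> span (f ` D)"
    then have "independent (insert v (f ` D))"
      using ind real_vector.independent_insert by (metis span_base)
    then have "card (insert v (f ` D)) \<le> card D"
      using real_vector.independent_span_bound[OF fD] D(2) by auto
    moreover have "v \<notin> f ` D" using v span_base[of v "f ` D"] by auto
    moreover have "card (f ` D) = card D"
      by (rule card_image) (rule inj_on_subset[OF assms(4) subset_UNIV])
    ultimately show False using fD by simp
  qed
  then show ?thesis
    using linear_span_image[OF assms(3), of D] unfolding D(2) by blast
qed

text \<open>A linear left inverse is bounded, and its bound is the constant sought.\<close>

lemma linear_inj_lower_bound:
  fixes f :: "'a::real_inner \<Rightarrow> 'a"
  assumes "onb_of (UNIV :: 'a set) B" "linear f" "inj f"
  obtains K where "K > 0" "\<And>u. norm u \<le> K * norm (f u)"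
proof -
  obtain g where g: "linear g" "g \<circ> f = id"
    using linear_injective_left_inverse[OF assms(2,3)] by blast
  \<comment> \<open>The summand 1 keeps \<open>K\<close> positive even when \<open>B\<close> is
    empty.\<close>
  define K where "K = (\<Sum>b\<in>B. norm (g b)) + 1"
  have "norm u \<le> K * norm (f u)" for u
  proof -
    have "norm (g (f u)) \<le> (\<Sum>b\<in>B. norm (g b)) * norm (f u)"
      by (rule onb_of_linear_bound[OF assms(1) g(1)])
    also have "\<dots> \<le> K * norm (f u)"
      by (rule mult_right_mono) (auto simp: K_def)
    finally show ?thesis
      using g(2) by (metis comp_apply id_apply)
  qed
  moreover have "K > 0"
    unfolding K_def by (intro add_nonneg_pos sum_nonneg) auto
  ultimately show thesis by (rule that[rotated])
qed

text \<open>Subtracting the equations at \<open>y\<close> and \<open>y'\<close> gives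
  \<open>W y (Z t y - Z t y', \<cdot>) = F t y - F t y' - (W y - W y') (Z t y', \<cdot>)\<close>, and \<open>W y\<close> is uniformly
  invertible for \<open>y\<close> near \<open>y0\<close>.\<close>

lemma linear_solution_lipschitz:
  fixes W :: "'a::real_inner \<Rightarrow> 'a \<Rightarrow> 'a \<Rightarrow> real" and Z :: "'t \<Rightarrow> 'a \<Rightarrow> 'a"
  assumes B: "onb_of UNIV B" and "y0 \<in> U" "r0 > 0" "ball y0 r0 \<subseteq> U" "0 \<le> L1" "0 \<le> L2" "0 \<le> M"
    and lin: "\<And>y b. y \<in> U \<Longrightarrow> linear (\<lambda>a. W y a b)"
    and linr: "\<And>y a. y \<in> U \<Longrightarrow> linear (\<lambda>b. W y a b)"
    and nondeg: "\<And>u. (\<And>b. W y0 u b = 0) \<Longrightarrow> u = 0"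
    and WL: "\<And>y y' a b. y \<in> U \<Longrightarrow> y' \<in> U \<Longrightarrow> a \<in> B \<Longrightarrow> b \<in> B \<Longrightarrow>
               \<bar>W y a b - W y' a b\<bar> \<le> L1 * norm (y - y')"
    and ZF: "\<And>t y b. t \<in> T \<Longrightarrow> y \<in> U \<Longrightarrow> b \<in> B \<Longrightarrow> W y (Z t y) b = F t y b"
    and FL: "\<And>t y y' b. t \<in> T \<Longrightarrow> y \<in> U \<Longrightarrow> y' \<in> U \<Longrightarrow> b \<in> B \<Longrightarrow>
               \<bar>F t y b - F t y' b\<bar> \<le> L2 * norm (y - y')"
    and FM: "\<And>t y b. t \<in> T \<Longrightarrow> y \<in> U \<Longrightarrow> b \<in> B \<Longrightarrow> \<bar>F t y b\<bar> \<le> M"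
  obtains r L where "r > 0" "r \<le> r0" "L \<ge> 0"
    "\<And>t y y'. t \<in> T \<Longrightarrow> y \<in> ball y0 r \<Longrightarrow> y' \<in> ball y0 r \<Longrightarrow>
       norm (Z t y - Z t y') \<le> L * norm (y - y')"
proof -
  define N where "N = real (card B)"
  have N: "N \<ge> 0" by (simp add: N_def)
  \<comment> \<open>\<open>T' y u\<close> is the vector that represents the functional
    \<open>W y u\<close>. It turns the form into an endomorphism, to which the lower bound for
    injective maps applies at \<open>y0\<close>.\<close>
  define T' where "T' y u = (\<Sum>b\<in>B. W y u b *\<^sub>R b)" for y u
  have sum_bound: "norm (\<Sum>b\<in>B. f b *\<^sub>R b) \<le> N * k" if "\<And>b. b \<in> B \<Longrightarrow> \<bar>f b\<bar> \<le> k" for f k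
  proof -
    have "norm (\<Sum>b\<in>B. f b *\<^sub>R b) \<le> (\<Sum>b\<in>B. k)"
      using that onb_of_norm[OF B] by (intro sum_norm_le) auto
    then show ?thesis by (simp add: N_def)
  qed
  have linT: "linear (T' y)" if "y \<in> U" for y
    unfolding T'_def using linear_add[OF lin[OF that]] linear_scale[OF lin[OF that]]
    by (intro linearI) (auto simp: sum.distrib scaleR_add_left scaleR_sum_right)
  have "inj (T' y0)"
  proof (subst linear_injective_0[OF linT[OF \<open>y0 \<in> U\<close>]], safe)
    fix u assume "T' y0 u = 0"
    have "W y0 u b = 0" if "b \<in> B" for b
    proof -
      have "0 = T' y0 u \<bullet> b" using \<open>T' y0 u = 0\<close> by simp
      also have "\<dots> = (\<Sum>a\<in>B. W y0 u a * (a \<bullet> b))"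
        by (simp add: T'_def inner_sum_left)
      also have "\<dots> = (\<Sum>a\<in>B. if a = b then W y0 u a else 0)"
        using B that by (intro sum.cong) (auto simp: onb_of_def)
      finally show ?thesis using B that by (simp add: onb_of_def)
    qed
    then have "W y0 u b = 0" for b
      using onb_of_linear_expansion[OF B linr[OF \<open>y0 \<in> U\<close>], of u b] by simp
    then show "u = 0" by (rule nondeg)
  qed
  then obtain K where K: "K > 0" "\<And>u. norm u \<le> K * norm (T' y0 u)"
    using linear_inj_lower_bound[OF B linT[OF \<open>y0 \<in> U\<close>]] by metis
  \<comment> \<open>One factor \<open>N\<close> comes from expanding \<open>u\<close> in the basis,
    the other from summing over the output coordinates.\<close>
  define C where "C = N * (N * L1)"
  have C: "C \<ge> 0" using \<open>0 \<le> L1\<close> N by (simp add: C_def)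
  have TL: "norm (T' y u - T' y' u) \<le> C * norm (y - y') * norm u" if yU: "y \<in> U" "y' \<in> U" for y y' u
  proof -
    have "\<bar>W y u b - W y' u b\<bar> \<le> N * (L1 * norm (y - y') * norm u)" if b: "b \<in> B" for b
    proof -
      have "W y u b - W y' u b = (\<Sum>a\<in>B. (u \<bullet> a) * (W y a b - W y' a b))"
        using onb_of_linear_expansion[OF B lin[OF \<open>y \<in> U\<close>], of u b]
              onb_of_linear_expansion[OF B lin[OF \<open>y' \<in> U\<close>], of u b]
        by (simp add: right_diff_distrib sum_subtractf)
      also have "\<bar>\<dots>\<bar> \<le> (\<Sum>a\<in>B. norm u * (L1 * norm (y - y')))"
      proof (rule order.trans[OF sum_abs], rule sum_mono)
        fix a assume a: "a \<in> B"
        show "\<bar>(u \<bullet> a) * (W y a b - W y' a b)\<bar> \<le> norm u * (L1 * norm (y - y'))"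
          unfolding abs_mult
          using onb_of_inner_le[OF B a] WL[OF yU a b] by (intro mult_mono) auto
      qed
      finally show ?thesis by (simp add: N_def mult_ac)
    qed
    then have "norm (\<Sum>b\<in>B. (W y u b - W y' u b) *\<^sub>R b) \<le> N * (N * (L1 * norm (y - y') * norm u))"
      by (rule sum_bound)
    then show ?thesis
      by (simp add: T'_def C_def scaleR_left_diff_distrib sum_subtractf mult_ac)
  qed
  \<comment> \<open>Within this radius, \<open>K\<close> times the deviation of \<open>T' y\<close>
    from \<open>T' y0\<close> is at most 1/2, so half of \<open>norm u\<close> can be absorbed on
    the left. The denominator uses \<open>C + 1\<close> because \<open>C\<close> may be 0.\<close>
  define r where "r = min r0 (1 / (2 * K * (C + 1)))"
  have r: "r > 0" "r \<le> r0" "K * C * r \<le> 1 / 2"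
  proof -
    show "r > 0" "r \<le> r0" using K C \<open>r0 > 0\<close> by (auto simp: r_def)
    have "K * C * r \<le> K * C * (1 / (2 * K * (C + 1)))"
      using K C by (intro mult_left_mono) (auto simp: r_def)
    also have "\<dots> = C / (C + 1) / 2" using K(1) C by (simp add: divide_simps)
    also have "\<dots> \<le> 1 / 2" using C by simp
    finally show "K * C * r \<le> 1 / 2" .
  qed
  have lower: "norm u \<le> 2 * K * norm (T' y u)" if y: "y \<in> ball y0 r" for y u
  proof -
    have yU: "y \<in> U" using y r assms(4) by auto
    have "norm (T' y0 u) \<le> norm (T' y u) + norm (T' y0 u - T' y u)"
      by (simp add: norm_triangle_sub)
    also have "\<dots> \<le> norm (T' y u) + C * norm (y0 - y) * norm u"
      using TL[OF \<open>y0 \<in> U\<close> yU] by simp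
    also have "\<dots> \<le> norm (T' y u) + C * r * norm u"
      using y C by (intro add_left_mono mult_right_mono mult_left_mono) (auto simp: dist_norm)
    finally have "K * norm (T' y0 u) \<le> K * (norm (T' y u) + C * r * norm u)"
      using K by simp
    also have "\<dots> = K * norm (T' y u) + (K * C * r) * norm u" by (simp add: algebra_simps)
    also have "\<dots> \<le> K * norm (T' y u) + 1 / 2 * norm u"
      using r by (intro add_left_mono mult_right_mono) auto
    finally show ?thesis using K(2)[of u] by simp
  qed
  \<comment> \<open>\<open>N * L2\<close> accounts for the variation of \<open>F\<close>; the second
    summand is the variation of \<open>W\<close> times the a priori bound
    \<open>2 * K * (N * M)\<close> on \<open>Z\<close>.\<close>
  define L where "L = 2 * K * (N * L2 + C * (2 * K * (N * M)))"
  have "L \<ge> 0" using K C N assms by (simp add: L_def)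
  have "norm (Z t y - Z t y') \<le> L * norm (y - y')"
    if t: "t \<in> T" and y: "y \<in> ball y0 r" and y': "y' \<in> ball y0 r" for t y y'
  proof -
    have yU: "y \<in> U" "y' \<in> U" using y y' r assms(4) by auto
    have TF: "T' z (Z t z) = (\<Sum>b\<in>B. F t z b *\<^sub>R b)" if "z \<in> U" for z
      using ZF[OF t that] by (simp add: T'_def)
    have "norm (Z t y') \<le> 2 * K * norm (T' y' (Z t y'))" by (rule lower[OF y'])
    also have "\<dots> \<le> 2 * K * (N * M)"
      unfolding TF[OF yU(2)] using FM[OF t yU(2)] K
      by (intro mult_left_mono sum_bound) auto
    finally have Zb: "norm (Z t y') \<le> 2 * K * (N * M)" .
    have "T' y (Z t y - Z t y') = (T' y (Z t y) - T' y' (Z t y')) - (T' y (Z t y') - T' y' (Z t y'))"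
      by (simp add: linear_diff[OF linT[OF yU(1)]])
    then have "norm (T' y (Z t y - Z t y')) \<le>
        norm (T' y (Z t y) - T' y' (Z t y')) + norm (T' y (Z t y') - T' y' (Z t y'))"
      by (metis norm_triangle_ineq4)
    also have "\<dots> \<le> N * (L2 * norm (y - y')) + C * norm (y - y') * (2 * K * (N * M))"
    proof (rule add_mono)
      have "norm (\<Sum>b\<in>B. (F t y b - F t y' b) *\<^sub>R b) \<le> N * (L2 * norm (y - y'))"
        using FL[OF t yU] by (intro sum_bound) auto
      then show "norm (T' y (Z t y) - T' y' (Z t y')) \<le> N * (L2 * norm (y - y'))"
        by (simp add: TF[OF yU(1)] TF[OF yU(2)] scaleR_left_diff_distrib sum_subtractf)
      have "norm (T' y (Z t y') - T' y' (Z t y')) \<le> C * norm (y - y') * norm (Z t y')"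
        by (rule TL[OF yU])
      also have "\<dots> \<le> C * norm (y - y') * (2 * K * (N * M))"
        using Zb C by (intro mult_left_mono) auto
      finally show "norm (T' y (Z t y') - T' y' (Z t y')) \<le> C * norm (y - y') * (2 * K * (N * M))" .
    qed
    finally have "norm (T' y (Z t y - Z t y')) \<le> (N * L2 + C * (2 * K * (N * M))) * norm (y - y')"
      by (simp add: algebra_simps)
    then have "2 * K * norm (T' y (Z t y - Z t y')) \<le>
        2 * K * ((N * L2 + C * (2 * K * (N * M))) * norm (y - y'))"
      using K by (intro mult_left_mono) auto
    then show ?thesis
      using lower[OF y, of "Z t y - Z t y'"] by (simp add: L_def mult.assoc)
  qed
  then show thesis using that r \<open>L \<ge> 0\<close> by blast
qed

text \<open>\<open>Ck_on\<close> yields continuity of each directional derivative separately. The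
  sum \<open>k\<close> of their norms over the basis bounds the operator norm and is continuous, so
  it stays below \<open>k x0 + 1\<close> on a ball, and the mean value inequality applies there by
  convexity.\<close>

lemma C1_locally_lipschitz:
  fixes f :: "'a::real_inner \<Rightarrow> 'b::real_normed_vector"
  assumes B: "onb_of (UNIV :: 'a set) B" and "open U" "x0 \<in> U" "Ck_on (Suc 0) U f"
  obtains r L where "r > 0" "L \<ge> 0" "ball x0 r \<subseteq> U"
    "\<And>x y. x \<in> ball x0 r \<Longrightarrow> y \<in> ball x0 r \<Longrightarrow> norm (f x - f y) \<le> L * norm (x - y)"
proof -
  define Df where "Df x = frechet_derivative f (at x)" for x
  have der: "(f has_derivative Df x) (at x)" if "x \<in> U" for x
    using assms(4) that frechet_derivative_works by (auto simp: Df_def)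
  have cont: "continuous_on U (\<lambda>x. Df x b)" for b
    using assms(4) by (simp add: Df_def)
  define k where "k x = (\<Sum>b\<in>B. norm (Df x b))" for x
  have "continuous_on U k"
    unfolding k_def by (intro continuous_intros cont)
  then have "\<forall>\<^sub>F x in nhds x0. k x < k x0 + 1"
    by (intro order_tendstoD[where y="k x0"])
       (use assms in \<open>auto simp: continuous_on_eq_continuous_at isCont_def tendsto_at_iff_tendsto_nhds\<close>)
  moreover have "\<forall>\<^sub>F x in nhds x0. x \<in> U"
    using assms by (simp add: eventually_nhds_in_open)
  ultimately have "\<forall>\<^sub>F x in nhds x0. k x < k x0 + 1 \<and> x \<in> U"
    by (rule eventually_conj)
  then obtain r where r: "r > 0" "\<And>x. x \<in> ball x0 r \<Longrightarrow> k x < k x0 + 1 \<and> x \<in> U"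
    unfolding eventually_nhds_metric by (metis dist_commute mem_ball)
  have "norm (f x - f y) \<le> (k x0 + 1) * norm (x - y)" if xy: "x \<in> ball x0 r" "y \<in> ball x0 r" for x y
  proof (rule differentiable_bound[OF convex_ball _ _ xy])
    fix z assume z: "z \<in> ball x0 r"
    show "(f has_derivative Df z) (at z within ball x0 r)"
      using der r(2)[OF z] by (simp add: has_derivative_at_withinI)
    have "linear (Df z)"
      using der r(2)[OF z] has_derivative_linear by blast
    show "onorm (Df z) \<le> k x0 + 1"
    proof (rule onorm_bound)
      show "0 \<le> k x0 + 1" by (simp add: k_def sum_nonneg)
      fix v
      have "norm (Df z v) \<le> k z * norm v"
        unfolding k_def by (rule onb_of_linear_bound[OF B \<open>linear (Df z)\<close>])
      also have "\<dots> \<le> (k x0 + 1) * norm v"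
        using r(2)[OF z] by (intro mult_right_mono) auto
      finally show "norm (Df z v) \<le> (k x0 + 1) * norm v" .
    qed
  qed
  moreover have "k x0 + 1 \<ge> 0" by (simp add: k_def sum_nonneg)
  ultimately show thesis using that r by blast
qed

text \<open>Finitely many local estimates, one per basis index, can share the smallest radius and
  the largest constant.\<close>

lemma uniform_radius:
  fixes P :: "'b \<Rightarrow> real \<Rightarrow> real \<Rightarrow> bool"
  assumes "finite B" "\<And>b. b \<in> B \<Longrightarrow> \<exists>r>0. \<exists>L\<ge>0. P b r L"
    and "\<And>b r L r' L'. P b r L \<Longrightarrow> 0 < r' \<Longrightarrow> r' \<le> r \<Longrightarrow> L \<le> L' \<Longrightarrow> P b r' L'"
  shows "\<exists>r>0. \<exists>L\<ge>0. \<forall>b\<in>B. P b r L"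
  using assms(1,2)
proof (induction B rule: finite_induct)
  case empty
  then show ?case by (auto intro: exI[of _ 1])
next
  case (insert b B)
  obtain r L where 1: "r > 0" "L \<ge> 0" "\<forall>b\<in>B. P b r L" using insert by auto
  obtain r' L' where 2: "r' > 0" "L' \<ge> 0" "P b r' L'" using insert.prems by blast
  have "P a (min r r') (max L L')" if "a \<in> B" for a
    by (rule assms(3)[of a r L]) (use that 1 2 in auto)
  moreover have "P b (min r r') (max L L')"
    by (rule assms(3)[of b r' L']) (use 1 2 in auto)
  ultimately show ?case using 1 2
    by (intro exI[of _ "min r r'"] conjI exI[of _ "max L L'"]) auto
qed


section \<open>Charts, tangent vectors and Hamiltonian vector fields\<close>

lemma is_chartD:
  assumes "is_chart c"
  shows "open (dom_of c)" "open (cod_of c)" "continuous_on (dom_of c) (coord c)"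
    "continuous_on (cod_of c) (param c)" "\<And>p. p \<in> dom_of c \<Longrightarrow> param c (coord c p) = p"
    "\<And>y. y \<in> cod_of c \<Longrightarrow> coord c (param c y) = y" "\<And>y. y \<in> cod_of c \<Longrightarrow> param c y \<in> dom_of c"
  using assms by (auto simp: is_chart_def homeomorphism_def f_inv_into_f inv_into_into)

lemma open_coord_image:
  assumes "is_chart c" "open U" "U \<subseteq> dom_of c"
  shows "open (coord c ` U)"
proof -
  have "coord c ` U = cod_of c \<inter> param c -` U"
    using is_chartD(5-7)[OF assms(1)] assms(3) by force
  then show ?thesis
    using continuous_open_preimage[OF is_chartD(4)[OF assms(1)] is_chartD(2)[OF assms(1)] assms(2)]
    by simp
qed

lemma smooth_on_imp_differentiable:
  assumes "smooth_on S f" "open S" "x \<in> S"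
  shows "f differentiable (at x)"
proof -
  obtain W g where W: "open W" "x \<in> W" "\<And>k. Ck_on k W g" "\<And>y. y \<in> S \<inter> W \<Longrightarrow> g y = f y"
    using assms unfolding smooth_on_def by meson
  have "g differentiable (at x)"
    using W(3)[of "Suc 0"] W(2) by simp
  then obtain g' where "(g has_derivative g') (at x)"
    by (auto simp: differentiable_def)
  then have "(f has_derivative g') (at x)"
    by (rule has_derivative_transform_within_open[where s="S \<inter> W"]) (use W assms in auto)
  then show ?thesis by (auto simp: differentiable_def)
qed

lemma smooth_on_subset: "smooth_on S f \<Longrightarrow> T \<subseteq> S \<Longrightarrow> smooth_on T f"
  unfolding smooth_on_def
proof (rule ballI)
  fix x assume *: "\<forall>x\<in>S. \<exists>W g. open W \<and> x \<in> W \<and> (\<forall>k. Ck_on k W g) \<and> (\<forall>y\<in>S \<inter> W. g y = f y)"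
    and "T \<subseteq> S" "x \<in> T"
  then have "x \<in> S" by (simp add: subset_eq)
  with * obtain W g where
    "open W" "x \<in> W" "\<forall>k. Ck_on k W g" "\<forall>y\<in>S \<inter> W. g y = f y"
    by metis
  then show "\<exists>W g. open W \<and> x \<in> W \<and> (\<forall>k. Ck_on k W g) \<and> (\<forall>y\<in>T \<inter> W. g y = f y)"
    using \<open>T \<subseteq> S\<close> by (intro exI[of _ W] exI[of _ g]) auto
qed

lemma smooth_manifold_is_chart: "smooth_manifold A \<Longrightarrow> c \<in> A \<Longrightarrow> is_chart c"
  by (simp add: smooth_manifold_def)

lemma smooth_manifold_onb_of:
  fixes A :: "('m::{t2_space,second_countable_topology}, 'e::real_inner) chart set"
  assumes "smooth_manifold A" "subspace S"
  obtains B where "onb_of (S :: 'e set) B"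
  using assms onb_of_exists by (metis smooth_manifold_def)

lemma transition_differentiable:
  assumes "smooth_manifold A" "c \<in> A" "d \<in> A" "p \<in> dom_of c" "p \<in> dom_of d"
  shows "(coord d \<circ> param c) differentiable (at (coord c p))"
proof (rule smooth_on_imp_differentiable)
  show "smooth_on (coord c ` (dom_of c \<inter> dom_of d)) (coord d \<circ> param c)"
    using assms by (simp add: smooth_manifold_def smooth_transition_def)
  show "open (coord c ` (dom_of c \<inter> dom_of d))"
    using assms by (intro open_coord_image open_Int is_chartD smooth_manifold_is_chart) auto
qed (use assms in auto)

text \<open>Chain rule for \<open>f \<circ> param c = (f \<circ> param d) \<circ> (coord d \<circ>
  param c)\<close>, an identity that holds only over the overlap of the charts, whose coordinate
  image is open. The codomain of \<open>f\<close> is general, so that \<open>f\<close> may be a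
  function on the manifold as well as a coordinate map.\<close>

lemma has_derivative_change_chart:
  assumes A: "smooth_manifold A" and c: "c \<in> charts_at A p" and d: "d \<in> charts_at A p"
    and f: "(f \<circ> param d) differentiable (at (coord d p))"
  shows "((f \<circ> param c) has_derivative
      frechet_derivative (f \<circ> param d) (at (coord d p)) \<circ>
      frechet_derivative (coord d \<circ> param c) (at (coord c p))) (at (coord c p))"
proof -
  have cd: "c \<in> A" "d \<in> A" "p \<in> dom_of c" "p \<in> dom_of d"
    using c d by (auto simp: charts_at_def)
  note C = is_chartD[OF smooth_manifold_is_chart[OF A cd(1)]]
  note D = is_chartD[OF smooth_manifold_is_chart[OF A cd(2)]]
  have tp: "(coord d \<circ> param c) (coord c p) = coord d p"
    using C(5) cd by simp
  have "(((f \<circ> param d) \<circ> (coord d \<circ> param c)) has_derivative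
      frechet_derivative (f \<circ> param d) (at (coord d p)) \<circ>
      frechet_derivative (coord d \<circ> param c) (at (coord c p))) (at (coord c p))"
    using transition_differentiable[OF A cd] f
    by (intro diff_chain_at) (simp_all add: tp[unfolded comp_apply] flip: frechet_derivative_works)
  then show ?thesis
  proof (rule has_derivative_transform_within_open)
    show "open (coord c ` (dom_of c \<inter> dom_of d))"
      using cd A C(1) D(1) by (intro open_coord_image smooth_manifold_is_chart[OF A] open_Int) auto
    show "((f \<circ> param d) \<circ> (coord d \<circ> param c)) y = (f \<circ> param c) y"
      if "y \<in> coord c ` (dom_of c \<inter> dom_of d)" for y
      using that C(5) D(5) by auto
  qed (use cd in auto)
qed

lemma frechet_derivative_change_chart:
  assumes "smooth_manifold A" "c \<in> charts_at A p" "d \<in> charts_at A p"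
    and "(f \<circ> param d) differentiable (at (coord d p))"
  shows "frechet_derivative (f \<circ> param c) (at (coord c p)) a =
    frechet_derivative (f \<circ> param d) (at (coord d p))
      (frechet_derivative (coord d \<circ> param c) (at (coord c p)) a)"
  unfolding frechet_derivative_at[OF has_derivative_change_chart[OF assms], symmetric] o_apply ..

lemma transition_derivative_self:
  assumes A: "smooth_manifold A" and c: "c \<in> charts_at A p"
  shows "frechet_derivative (coord c \<circ> param c) (at (coord c p)) = (\<lambda>a. a)"
proof -
  have c': "c \<in> A" "p \<in> dom_of c" using c by (auto simp: charts_at_def)
  note C = is_chartD[OF smooth_manifold_is_chart[OF A c'(1)]]
  have "((coord c \<circ> param c) has_derivative (\<lambda>a. a)) (at (coord c p))"
    by (rule has_derivative_transform_within_open[OF has_derivative_ident C(2)])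
       (use c' C in auto)
  from frechet_derivative_at[OF this] show ?thesis by simp
qed

text \<open>The cocycle identity of the tangent bundle: the change of chart formula applied to
  \<open>coord e\<close>.\<close>

lemma transition_derivative_comp:
  assumes A: "smooth_manifold A"
    and c: "c \<in> charts_at A p" and d: "d \<in> charts_at A p" and e: "e \<in> charts_at A p"
  shows "frechet_derivative (coord e \<circ> param c) (at (coord c p)) a =
    frechet_derivative (coord e \<circ> param d) (at (coord d p))
      (frechet_derivative (coord d \<circ> param c) (at (coord c p)) a)"
proof -
  have "(coord e \<circ> param d) differentiable (at (coord d p))"
    using transition_differentiable[OF A] d e by (auto simp: charts_at_def)
  from frechet_derivative_change_chart[OF A c d this] show ?thesis .
qed

lemma coord_vector_in_tangent_space:
  assumes "smooth_manifold A" "c \<in> charts_at A p"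
  shows "coord_vector A c p a \<in> tangent_space A p"
  unfolding tangent_space_def coord_vector_def
  by (simp add: transition_derivative_comp[OF assms, symmetric])

lemma coord_vector_self:
  assumes "smooth_manifold A" "c \<in> charts_at A p"
  shows "coord_vector A c p a c = a"
  using transition_derivative_self[OF assms] assms(2) by (simp add: coord_vector_def)

lemma tangent_space_transition:
  assumes "v \<in> tangent_space A p" "c \<in> charts_at A p" "d \<in> charts_at A p"
  shows "v d = frechet_derivative (coord d \<circ> param c) (at (coord c p)) (v c)"
  using assms unfolding tangent_space_def by blast

text \<open>The convention that tangent vectors vanish off \<open>charts_at A p\<close> is what
  makes this an equality of functions.\<close>

lemma tangent_space_eq_coord_vector:
  assumes "c \<in> charts_at A p" "v \<in> tangent_space A p"
  shows "v = coord_vector A c p (v c)"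
proof
  fix d
  have "d \<notin> charts_at A p \<Longrightarrow> v d = 0"
    using assms(2) unfolding tangent_space_def by blast
  then show "v d = coord_vector A c p (v c) d"
    using tangent_space_transition[OF assms(2,1), of d] by (simp add: coord_vector_def)
qed

text \<open>The description is well defined because the derivative of \<open>f\<close> and the
  coordinates of \<open>v\<close> change by mutually cancelling transition derivatives.
  Differentiability in one chart around \<open>p\<close> is enough.\<close>

lemma differential_in_chart:
  assumes A: "smooth_manifold A" and c: "c \<in> charts_at A p" and v: "v \<in> tangent_space A p"
    and f: "(f \<circ> param c) differentiable (at (coord c p))"
  shows "differential A f p v = frechet_derivative (f \<circ> param c) (at (coord c p)) (v c)"
  unfolding differential_def
proof (rule the_equality)
  show "\<forall>d\<in>charts_at A p. frechet_derivative (f \<circ> param c) (at (coord c p)) (v c) =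
      frechet_derivative (f \<circ> param d) (at (coord d p)) (v d)"
  proof
    fix d assume d: "d \<in> charts_at A p"
    have "frechet_derivative (f \<circ> param d) (at (coord d p)) (v d) =
      frechet_derivative (f \<circ> param c) (at (coord c p))
        (frechet_derivative (coord c \<circ> param d) (at (coord d p)) (v d))"
      by (rule frechet_derivative_change_chart[OF A d c f])
    also have "frechet_derivative (coord c \<circ> param d) (at (coord d p)) (v d) = v c"
      by (rule tangent_space_transition[OF v d c, symmetric])
    finally show "frechet_derivative (f \<circ> param c) (at (coord c p)) (v c) =
      frechet_derivative (f \<circ> param d) (at (coord d p)) (v d)" ..
  qed
qed (use c in blast)

lemma charts_at_param:
  assumes "smooth_manifold A" "c \<in> A" "y \<in> cod_of c"
  shows "c \<in> charts_at A (param c y)"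
  using is_chartD(7)[OF smooth_manifold_is_chart[OF assms(1,2)] assms(3)] assms(2)
  by (simp add: charts_at_def)

lemma coord_vector_linear:
  assumes A: "smooth_manifold A" and c: "c \<in> charts_at A p"
  shows "coord_vector A c p (r *\<^sub>R a + s *\<^sub>R b) =
    (\<lambda>d. r *\<^sub>R coord_vector A c p a d + s *\<^sub>R coord_vector A c p b d)"
proof
  fix d
  have "linear (frechet_derivative (coord d \<circ> param c) (at (coord c p)))" if "d \<in> charts_at A p"
    using transition_differentiable[OF A] that c
    by (intro linear_frechet_derivative) (auto simp: charts_at_def)
  then show "coord_vector A c p (r *\<^sub>R a + s *\<^sub>R b) d =
      r *\<^sub>R coord_vector A c p a d + s *\<^sub>R coord_vector A c p b d"
    by (auto simp: coord_vector_def linear_add linear_scale)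
qed

lemma form_coord_antisym:
  assumes A: "smooth_manifold A" and \<omega>: "smooth_two_form A \<omega>" and c: "c \<in> A" "y \<in> cod_of c"
  shows "form_coord A \<omega> c a b y = - form_coord A \<omega> c b a y"
  using \<omega> coord_vector_in_tangent_space[OF A charts_at_param[OF A c]]
  unfolding form_coord_def smooth_two_form_def by blast

lemma form_coord_linear_left:
  assumes A: "smooth_manifold A" and \<omega>: "smooth_two_form A \<omega>" and c: "c \<in> A" "y \<in> cod_of c"
  shows "linear (\<lambda>a. form_coord A \<omega> c a b y)"
proof -
  let ?p = "param c y"
  let ?v = "coord_vector A c ?p"
  have cp: "c \<in> charts_at A ?p" by (rule charts_at_param[OF A c])
  have comb: "\<omega> ?p (?v (r *\<^sub>R a + s *\<^sub>R a')) (?v b) = r * \<omega> ?p (?v a) (?v b) + s * \<omega> ?p (?v a') (?v b)"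
    for r s a a'
    unfolding coord_vector_linear[OF A cp]
    using \<omega> coord_vector_in_tangent_space[OF A cp] unfolding smooth_two_form_def by blast
  show ?thesis
    \<comment> \<open>Both coefficients equal to 1 give additivity; a vanishing second term gives
      homogeneity.\<close>
    using comb[of 1 _ 1] comb[of _ _ 0 0]
    by (intro linearI) (simp_all add: form_coord_def)
qed

lemma form_coord_linear_right:
  assumes A: "smooth_manifold A" and \<omega>: "smooth_two_form A \<omega>" and c: "c \<in> A" "y \<in> cod_of c"
  shows "linear (\<lambda>b. form_coord A \<omega> c a b y)"
  unfolding form_coord_antisym[OF assms, of a]
  using linear_compose_neg[OF form_coord_linear_left[OF assms, of a]] .

text \<open>Every tangent vector is the \<open>coord_vector\<close> of its own coordinates, so
  testing against coordinate vectors suffices.\<close>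

lemma form_coord_nondegenerate:
  assumes A: "smooth_manifold A" and "nondegenerate A \<omega>" and c: "c \<in> A" "y \<in> cod_of c"
    and zero: "\<And>b. form_coord A \<omega> c a b y = 0"
  shows "a = 0"
proof -
  let ?p = "param c y"
  let ?v = "coord_vector A c ?p"
  have cp: "c \<in> charts_at A ?p" by (rule charts_at_param[OF A c])
  have "\<omega> ?p (?v a) w = 0" if "w \<in> tangent_space A ?p" for w
    using zero[of "w c"] tangent_space_eq_coord_vector[OF cp that] by (simp add: form_coord_def)
  then have "?v a = (\<lambda>_. 0)"
    using assms(2) coord_vector_in_tangent_space[OF A cp] unfolding nondegenerate_def by blast
  then show ?thesis using coord_vector_self[OF A cp, of a] by simp
qed

lemma hamiltonian_vector_field_exists:
  fixes A :: "('m::{t2_space,second_countable_topology}, 'e::real_inner) chart set"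
  assumes S: "symplectic_manifold A \<omega>" and c: "c \<in> A" "y \<in> cod_of c"
    and f: "(f \<circ> param c) differentiable (at y)"
  defines "p \<equiv> param c y"
  shows "\<exists>!u. u \<in> tangent_space A p \<and> (\<forall>w\<in>tangent_space A p. \<omega> p u w = differential A f p w)"
proof -
  have A: "smooth_manifold A" and \<omega>: "smooth_two_form A \<omega>" and nd: "nondegenerate A \<omega>"
    using S by (auto simp: symplectic_manifold_def)
  obtain B where B: "onb_of (UNIV :: 'e set) B"
    using smooth_manifold_onb_of[OF A subspace_UNIV] .
  let ?W = "\<lambda>a b. form_coord A \<omega> c a b y"
  let ?v = "coord_vector A c p"
  have cp: "c \<in> charts_at A p" unfolding p_def by (rule charts_at_param[OF A c])
  have yp: "coord c p = y"
    using is_chartD(6)[OF smooth_manifold_is_chart[OF A c(1)] c(2)] by (simp add: p_def)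
  note linl = form_coord_linear_left[OF A \<omega> c] and linr = form_coord_linear_right[OF A \<omega> c]
  \<comment> \<open>\<open>T a\<close> represents the functional \<open>\<omega>(a, \<cdot>)\<close>
    in coordinates. Nondegeneracy makes \<open>T\<close> injective, hence surjective, so the vector
    representing the differential of \<open>f\<close> has a preimage.\<close>
  define T where "T a = (\<Sum>b\<in>B. ?W a b *\<^sub>R b)" for a
  have Tb: "T a \<bullet> b = ?W a b" if "b \<in> B" for a b
  proof -
    have "T a \<bullet> b = (\<Sum>b'\<in>B. if b' = b then ?W a b' else 0)"
      using B that by (auto simp: T_def inner_sum_left onb_of_def intro!: sum.cong)
    then show ?thesis using B that by (simp add: onb_of_def)
  qed
  have linT: "linear T"
    unfolding T_def using linear_add[OF linl] linear_scale[OF linl]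
    by (intro linearI) (auto simp: sum.distrib scaleR_add_left scaleR_sum_right)
  have "inj T"
  proof (subst linear_injective_0[OF linT], safe)
    fix a assume "T a = 0"
    then have "?W a b = 0" if "b \<in> B" for b using Tb[OF that, of a] by simp
    then have "?W a b = 0" for b
      using onb_of_linear_expansion[OF B linr, of a b] by simp
    then show "a = 0" by (rule form_coord_nondegenerate[OF A nd c])
  qed
  then have "surj T"
    using linear_inj_imp_surj_finite_span[OF _ _ linT] B by (auto simp: onb_of_def)
  let ?D = "frechet_derivative (f \<circ> param c) (at y)"
  obtain a where a: "T a = (\<Sum>b\<in>B. ?D b *\<^sub>R b)"
    using \<open>surj T\<close> by (metis surjD)
  have Wa: "?W a b = ?D b" if "b \<in> B" for b
  proof -
    have "T a \<bullet> b = (\<Sum>b'\<in>B. if b' = b then ?D b' else 0)"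
      unfolding a using B that by (auto simp: inner_sum_left onb_of_def intro!: sum.cong)
    then show ?thesis using B that Tb[OF that] by (simp add: onb_of_def)
  qed
  have linD: "linear ?D" using f by (rule linear_frechet_derivative)
  have "?W a b = ?D b" for b
    using onb_of_linear_expansion[OF B linr, of a b] onb_of_linear_expansion[OF B linD, of b] Wa
    by simp
  moreover have "differential A f p w = ?D (w c)" if "w \<in> tangent_space A p" for w
    using differential_in_chart[OF A cp that] f by (simp add: yp)
  moreover have "\<omega> p (?v a) w = ?W a (w c)" if "w \<in> tangent_space A p" for w
    using tangent_space_eq_coord_vector[OF cp that] by (simp add: form_coord_def p_def)
  ultimately have ex: "?v a \<in> tangent_space A p \<and>
      (\<forall>w\<in>tangent_space A p. \<omega> p (?v a) w = differential A f p w)"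
    using coord_vector_in_tangent_space[OF A cp] by simp
  show ?thesis
  proof (rule ex1I[where a="?v a"])
    fix u assume u: "u \<in> tangent_space A p \<and> (\<forall>w\<in>tangent_space A p. \<omega> p u w = differential A f p w)"
    have uv: "u = ?v (u c)" using u tangent_space_eq_coord_vector[OF cp] by blast
    have "?W (u c) b = ?W a b" for b
      using u ex uv coord_vector_in_tangent_space[OF A cp, of b]
      by (metis form_coord_def p_def)
    then have "?W (u c - a) b = 0" for b
      using linear_diff[OF linl] by simp
    then have "u c - a = 0" by (rule form_coord_nondegenerate[OF A nd c])
    then show "u = ?v a" using uv by simp
  qed (rule ex)
qed

text \<open>One equation in two readings: the one in terms of \<open>\<omega>\<close> is paired with
  isotropy later, the one in terms of \<open>form_coord\<close> is the linear system behind the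
  Lipschitz estimate.\<close>

lemma hamiltonian_vector_field_works:
  fixes A :: "('m::{t2_space,second_countable_topology}, 'e::real_inner) chart set"
  assumes S: "symplectic_manifold A \<omega>" and c: "c \<in> A" "y \<in> cod_of c"
    and f: "(f \<circ> param c) differentiable (at y)"
  defines "p \<equiv> param c y"
  defines "u \<equiv> hamiltonian_vector_field A \<omega> f p"
  shows "u \<in> tangent_space A p"
    and "\<omega> p u (coord_vector A c p b) = frechet_derivative (f \<circ> param c) (at y) b"
    and "form_coord A \<omega> c (u c) b y = frechet_derivative (f \<circ> param c) (at y) b"
proof -
  have A: "smooth_manifold A" using S by (auto simp: symplectic_manifold_def)
  have cp: "c \<in> charts_at A p" unfolding p_def by (rule charts_at_param[OF A c])
  have yp: "coord c p = y"
    using is_chartD(6)[OF smooth_manifold_is_chart[OF A c(1)] c(2)] by (simp add: p_def)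
  have u: "u \<in> tangent_space A p" "\<And>w. w \<in> tangent_space A p \<Longrightarrow> \<omega> p u w = differential A f p w"
    using theI'[OF hamiltonian_vector_field_exists[OF S c f], folded p_def]
    unfolding u_def hamiltonian_vector_field_def by blast+
  show "u \<in> tangent_space A p" by fact
  have "f \<circ> param c differentiable at (coord c p)" using f yp by simp
  then show 1: "\<omega> p u (coord_vector A c p b) = frechet_derivative (f \<circ> param c) (at y) b"
    using u(2) differential_in_chart[OF A cp] coord_vector_in_tangent_space[OF A cp]
      coord_vector_self[OF A cp] yp by simp
  show "form_coord A \<omega> c (u c) b y = frechet_derivative (f \<circ> param c) (at y) b"
    unfolding form_coord_def p_def[symmetric]
    using tangent_space_eq_coord_vector[OF cp u(1)] 1 by simp
qed


section \<open>Local Lipschitz continuity of the Hamiltonian vector field\<close>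

text \<open>The Hamiltonian is smooth jointly in time and space, so the C1 estimate is applied on
  \<open>real \<times> 'e\<close>, which needs a basis of its own.\<close>

lemma onb_of_time_product_exists:
  assumes B: "onb_of (UNIV :: 'e::real_inner set) B"
  obtains B' where "onb_of (UNIV :: (real \<times> 'e) set) B'"
proof -
  let ?C = "insert (1, 0) (Pair 0 ` B) :: (real \<times> 'e) set"
  have "(t, y) \<in> span ?C" for t :: real and y :: 'e
  proof -
    have "(t, y) = t *\<^sub>R (1, 0) + (\<Sum>b\<in>B. (y \<bullet> b) *\<^sub>R (0, b))"
      using onb_of_expansion[OF B, of y] by (simp add: prod_eq_iff fst_sum snd_sum)
    also have "\<dots> \<in> span ?C"
      by (intro span_add span_scale span_sum) (auto intro: span_base)
    finally show ?thesis .
  qed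
  then have "span ?C = UNIV" by auto
  moreover have "finite ?C" using B by (simp add: onb_of_def)
  ultimately show thesis using onb_of_exists[OF _ _ subspace_UNIV] that by blast
qed

text \<open>At times 0 and 1 smoothness only means that an extension \<open>g\<close> to an open set
  of space-time exists. Its derivative in spatial directions is nevertheless that of
  \<open>H t\<close> for \<open>t\<close> in \<open>{0..1}\<close>: with \<open>t\<close> fixed,
  \<open>g\<close> and \<open>H\<close> agree on an open set of points \<open>y\<close>.\<close>

lemma smooth_time_function_local:
  fixes A :: "('m::{t2_space,second_countable_topology}, 'e::real_inner) chart set"
  assumes A: "smooth_manifold A" and H: "smooth_time_function A H"
    and c: "c \<in> A" "y0 \<in> cod_of c" and t0: "t0 \<in> {0..1}"
  obtains W g where "open W" "(t0, y0) \<in> W" "\<And>k. Ck_on k W g"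
    "\<And>t y. t \<in> {0..1} \<Longrightarrow> y \<in> cod_of c \<Longrightarrow> (t, y) \<in> W \<Longrightarrow>
      ((H t \<circ> param c) has_derivative (\<lambda>a. frechet_derivative g (at (t, y)) (0, a))) (at y)"
proof -
  have "(t0, y0) \<in> {0..1} \<times> cod_of c" using c t0 by auto
  moreover have "smooth_on ({0..1} \<times> cod_of c) (\<lambda>(t, y). H t (param c y))"
    using H c by (simp add: smooth_time_function_def)
  ultimately obtain W g where W: "open W" "(t0, y0) \<in> W" "\<And>k. Ck_on k W g"
    "\<And>z. z \<in> ({0..1} \<times> cod_of c) \<inter> W \<Longrightarrow> g z = (\<lambda>(t, y). H t (param c y)) z"
    unfolding smooth_on_def by meson
  have "((H t \<circ> param c) has_derivative (\<lambda>a. frechet_derivative g (at (t, y)) (0, a))) (at y)"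
    if t: "t \<in> {0..1}" and y: "y \<in> cod_of c" and ty: "(t, y) \<in> W" for t y
  proof -
    have "(g has_derivative frechet_derivative g (at (t, y))) (at (t, y))"
      using W(3)[of "Suc 0"] ty by (simp flip: frechet_derivative_works)
    moreover have "((\<lambda>y. (t, y)) has_derivative (\<lambda>a. (0, a))) (at y)"
      by (auto intro!: derivative_eq_intros)
    ultimately have "((g \<circ> (\<lambda>y. (t, y))) has_derivative
        (frechet_derivative g (at (t, y)) \<circ> (\<lambda>a. (0, a)))) (at y)"
      by (intro diff_chain_at) auto
    then have "((g \<circ> (\<lambda>y. (t, y))) has_derivative
        (\<lambda>a. frechet_derivative g (at (t, y)) (0, a))) (at y)"
      by (simp add: o_def)
    then show ?thesis
    proof (rule has_derivative_transform_within_open)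
      show "open (cod_of c \<inter> (\<lambda>y. (t, y)) -` W)"
        using is_chartD(2)[OF smooth_manifold_is_chart[OF A c(1)]] \<open>open W\<close>
        by (intro open_Int open_vimage) (auto intro!: continuous_intros)
    qed (use y ty t W(4) in auto)
  qed
  then show thesis using that W(1-3) by blast
qed

lemma smooth_time_function_differentiable:
  fixes A :: "('m::{t2_space,second_countable_topology}, 'e::real_inner) chart set"
  assumes "smooth_manifold A" "smooth_time_function A H" "c \<in> A" "y \<in> cod_of c" "t \<in> {0..1}"
  shows "(H t \<circ> param c) differentiable (at y)"
proof -
  obtain W g where "(t, y) \<in> W" "\<And>t y. t \<in> {0..1} \<Longrightarrow> y \<in> cod_of c \<Longrightarrow> (t, y) \<in> W \<Longrightarrow>
      ((H t \<circ> param c) has_derivative (\<lambda>a. frechet_derivative g (at (t, y)) (0, a))) (at y)"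
    using smooth_time_function_local[OF assms] by metis
  then show ?thesis using assms unfolding differentiable_def by blast
qed

lemma form_coord_locally_lipschitz:
  fixes A :: "('m::{t2_space,second_countable_topology}, 'e::real_inner) chart set"
  assumes A: "smooth_manifold A" and \<omega>: "smooth_two_form A \<omega>"
    and B: "onb_of (UNIV :: 'e set) B" and c: "c \<in> A" "y0 \<in> cod_of c"
  shows "\<exists>r>0. \<exists>L\<ge>0. ball y0 r \<subseteq> cod_of c \<and> (\<forall>y\<in>ball y0 r. \<forall>y'\<in>ball y0 r.
    \<bar>form_coord A \<omega> c a b y - form_coord A \<omega> c a b y'\<bar> \<le> L * norm (y - y'))"
proof -
  have "smooth_on (cod_of c) (form_coord A \<omega> c a b)"
    using \<omega> c unfolding smooth_two_form_def by blast
  then obtain W g where W: "open W" "y0 \<in> W" "\<And>k. Ck_on k W g"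
    "\<And>y. y \<in> cod_of c \<inter> W \<Longrightarrow> g y = form_coord A \<omega> c a b y"
    using c(2) unfolding smooth_on_def by meson
  obtain r L where r: "r > 0" "L \<ge> 0" "ball y0 r \<subseteq> W"
    "\<And>x y. x \<in> ball y0 r \<Longrightarrow> y \<in> ball y0 r \<Longrightarrow> norm (g x - g y) \<le> L * norm (x - y)"
    using C1_locally_lipschitz[OF B W(1,2) W(3)] by metis
  obtain r' where r': "r' > 0" "ball y0 r' \<subseteq> cod_of c"
    using is_chartD(2)[OF smooth_manifold_is_chart[OF A c(1)]] c(2) openE by blast
  have sub: "y \<in> cod_of c \<inter> W" "y \<in> ball y0 r" if "y \<in> ball y0 (min r r')" for y
    using that r(3) r'(2) by auto
  have "\<bar>form_coord A \<omega> c a b y - form_coord A \<omega> c a b y'\<bar> \<le> L * norm (y - y')"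
    if "y \<in> ball y0 (min r r')" "y' \<in> ball y0 (min r r')" for y y'
    using r(4)[OF sub(2)[OF that(1)] sub(2)[OF that(2)]] W(4)[OF sub(1)[OF that(1)]]
      W(4)[OF sub(1)[OF that(2)]] by simp
  then show ?thesis
    using r r' sub(1) by (intro exI[of _ "min r r'"] exI[of _ L] conjI) auto
qed

lemma dist_Pair_le: "dist (s, x) (t, y) \<le> dist s t + dist x y"
  by (simp add: dist_Pair_Pair sqrt_sum_squares_le_sum)

text \<open>In coordinates the field solves a linear system whose left side does not depend on time
  and whose right side consists of the spatial derivatives of the extension of \<open>H\<close>.
  These are C1 jointly in time and space, which makes the constant uniform for \<open>t\<close> near
  \<open>t0\<close>.\<close>

lemma hamiltonian_vector_field_locally_lipschitz:
  fixes A :: "('m::{t2_space,second_countable_topology}, 'e::real_inner) chart set"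
  assumes S: "symplectic_manifold A \<omega>" and H: "smooth_time_function A H"
    and c: "c \<in> A" "y0 \<in> cod_of c" and t0: "t0 \<in> {0..1}"
  defines "Z \<equiv> \<lambda>t y. hamiltonian_vector_field A \<omega> (H t) (param c y) c"
  obtains r L where "r > 0" "L \<ge> 0" "ball y0 r \<subseteq> cod_of c"
    "\<And>t y y'. t \<in> {0..1} \<Longrightarrow> \<bar>t - t0\<bar> < r \<Longrightarrow> y \<in> ball y0 r \<Longrightarrow> y' \<in> ball y0 r \<Longrightarrow>
       norm (Z t y - Z t y') \<le> L * norm (y - y')"
proof -
  have A: "smooth_manifold A" and \<omega>: "smooth_two_form A \<omega>" and nd: "nondegenerate A \<omega>"
    using S by (auto simp: symplectic_manifold_def)
  obtain B where B: "onb_of (UNIV :: 'e set) B"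
    using smooth_manifold_onb_of[OF A subspace_UNIV] .
  have finB: "finite B" using B by (simp add: onb_of_def)
  obtain B' where B': "onb_of (UNIV :: (real \<times> 'e) set) B'"
    using onb_of_time_product_exists[OF B] .
  define P where "P = (\<lambda>(a, b) r L. ball y0 r \<subseteq> cod_of c \<and> (\<forall>y\<in>ball y0 r. \<forall>y'\<in>ball y0 r.
    \<bar>form_coord A \<omega> c a b y - form_coord A \<omega> c a b y'\<bar> \<le> L * norm (y - y')))"
  have "\<exists>r>0. \<exists>L\<ge>0. \<forall>ab\<in>B \<times> B. P ab r L"
  proof (rule uniform_radius)
    show "finite (B \<times> B)" using finB by simp
    show "\<exists>r>0. \<exists>L\<ge>0. P ab r L" for ab
      using form_coord_locally_lipschitz[OF A \<omega> B c] by (cases ab) (simp add: P_def)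
    show "P ab r' L'" if "P ab r L" "0 < r'" "r' \<le> r" "L \<le> L'" for ab r L r' L'
    proof -
      have "ball y0 r' \<subseteq> ball y0 r" using that by auto
      moreover have "L * norm (y - y') \<le> L' * norm (y - y')" for y y' :: 'e
        using that by (intro mult_right_mono) auto
      ultimately show ?thesis
        using that(1) unfolding P_def case_prod_beta by (meson order_trans subsetD subset_trans)
    qed
  qed
  then obtain rW LW where rW: "rW > 0" "LW \<ge> 0" "\<forall>ab\<in>B \<times> B. P ab rW LW" by blast
  obtain rc where rc: "rc > 0" "ball y0 rc \<subseteq> cod_of c"
    using is_chartD(2)[OF smooth_manifold_is_chart[OF A c(1)]] c(2) openE by blast
  obtain W g where W: "open W" "(t0, y0) \<in> W" "\<And>k. Ck_on k W g"
    "\<And>t y. t \<in> {0..1} \<Longrightarrow> y \<in> cod_of c \<Longrightarrow> (t, y) \<in> W \<Longrightarrow>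
      ((H t \<circ> param c) has_derivative (\<lambda>a. frechet_derivative g (at (t, y)) (0, a))) (at y)"
    using smooth_time_function_local[OF A H c t0] by blast
  define G where "G b = (\<lambda>z. frechet_derivative g (at z) (0, b))" for b
  define Q where "Q b r L \<longleftrightarrow> ball (t0, y0) r \<subseteq> W \<and> (\<forall>z\<in>ball (t0, y0) r. \<forall>z'\<in>ball (t0, y0) r.
    \<bar>G b z - G b z'\<bar> \<le> L * norm (z - z'))" for b r L
  have "\<exists>r>0. \<exists>L\<ge>0. \<forall>b\<in>B. Q b r L"
  proof (rule uniform_radius[OF finB])
    show "\<exists>r>0. \<exists>L\<ge>0. Q b r L" for b
    proof -
      have "Ck_on (Suc 0) W (G b)"
        using W(3)[of "Suc (Suc 0)"] unfolding G_def by (simp only: Ck_on.simps) blast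
      then obtain r L where "r > 0" "L \<ge> 0" "ball (t0, y0) r \<subseteq> W"
        "\<And>x y. x \<in> ball (t0, y0) r \<Longrightarrow> y \<in> ball (t0, y0) r \<Longrightarrow> norm (G b x - G b y) \<le> L * norm (x - y)"
        using C1_locally_lipschitz[OF B' W(1,2)] by metis
      then show ?thesis unfolding Q_def by (metis real_norm_def)
    qed
    show "Q b r' L'" if "Q b r L" "0 < r'" "r' \<le> r" "L \<le> L'" for b r L r' L'
    proof -
      have "ball (t0, y0) r' \<subseteq> ball (t0, y0) r" using that by auto
      moreover have "L * norm (y - y') \<le> L' * norm (y - y')" for y y' :: "real \<times> 'e"
        using that by (intro mult_right_mono) auto
      ultimately show ?thesis
        using that(1) unfolding Q_def by (meson order_trans subsetD)
    qed
  qed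
  then obtain rF LF where rF: "rF > 0" "LF \<ge> 0" "\<And>b. b \<in> B \<Longrightarrow> Q b rF LF" by blast
  \<comment> \<open>Half of \<open>rF\<close> is left for the time distance and half for the space
    distance, so that their sum controls the distance in the product. Since the final radius is at
    most \<open>r0\<close>, it can also bound the time distance.\<close>
  define r0 where "r0 = min (rF / 2) (min rW rc)"
  have "r0 > 0" using rF rW rc by (simp add: r0_def)
  define U where "U = ball y0 r0"
  define T where "T = {t \<in> {0..1}. \<bar>t - t0\<bar> < rF / 2}"
  have TU: "(t, y) \<in> ball (t0, y0) rF" if "t \<in> T" "y \<in> U" for t y
  proof -
    have "dist (t0, y0) (t, y) \<le> dist t0 t + dist y0 y" by (rule dist_Pair_le)
    also have "\<dots> < rF"
      using that by (auto simp: T_def U_def r0_def dist_real_def abs_minus_commute)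
    finally show ?thesis by simp
  qed
  have Uc: "U \<subseteq> cod_of c" using rc by (auto simp: U_def r0_def)
  \<comment> \<open>Values at the centre plus the largest variation that the Lipschitz constant
    allows on the ball.\<close>
  define M where "M = (\<Sum>b\<in>B. \<bar>G b (t0, y0)\<bar>) + LF * rF"
  have "M \<ge> 0" using rF by (simp add: M_def sum_nonneg)
  obtain r L where r: "r > 0" "r \<le> r0" "L \<ge> 0"
    "\<And>t y y'. t \<in> T \<Longrightarrow> y \<in> ball y0 r \<Longrightarrow> y' \<in> ball y0 r \<Longrightarrow>
       norm (Z t y - Z t y') \<le> L * norm (y - y')"
  proof (rule linear_solution_lipschitz[of B y0 U r0 LW LF M "\<lambda>y a b. form_coord A \<omega> c a b y"
        T Z "\<lambda>t y b. G b (t, y)"])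
    show "y0 \<in> U" "ball y0 r0 \<subseteq> U" using \<open>r0 > 0\<close> by (auto simp: U_def)
    show "linear (\<lambda>a. form_coord A \<omega> c a b y)" if "y \<in> U" for y b
      using form_coord_linear_left[OF A \<omega> c(1)] Uc that by blast
    show "linear (\<lambda>b. form_coord A \<omega> c a b y)" if "y \<in> U" for y a
      using form_coord_linear_right[OF A \<omega> c(1)] Uc that by blast
    show "u = 0" if "\<And>b. form_coord A \<omega> c u b y0 = 0" for u
      using form_coord_nondegenerate[OF A nd c that] .
    show "\<bar>form_coord A \<omega> c a b y - form_coord A \<omega> c a b y'\<bar> \<le> LW * norm (y - y')"
      if "y \<in> U" "y' \<in> U" "a \<in> B" "b \<in> B" for y y' a b
    proof -
      have "P (a, b) rW LW" using rW(3) that by blast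
      then show ?thesis using that by (auto simp: P_def U_def r0_def)
    qed
    show "form_coord A \<omega> c (Z t y) b y = G b (t, y)" if "t \<in> T" "y \<in> U" "b \<in> B" for t y b
    proof -
      have t: "t \<in> {0..1}" and y: "y \<in> cod_of c" using that Uc by (auto simp: T_def)
      have "(t, y) \<in> W" using TU[OF that(1,2)] rF(3)[OF that(3)] by (auto simp: Q_def)
      from frechet_derivative_at[OF W(4)[OF t y this]]
      have "frechet_derivative (H t \<circ> param c) (at y) b = G b (t, y)" by (metis G_def)
      then show ?thesis
        using hamiltonian_vector_field_works(3)[OF S c(1) y smooth_time_function_differentiable[OF A H c(1) y t]]
        by (simp add: Z_def)
    qed
    show "\<bar>G b (t, y) - G b (t, y')\<bar> \<le> LF * norm (y - y')"
      if "t \<in> T" "y \<in> U" "y' \<in> U" "b \<in> B" for t y y' b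
    proof -
      have "\<bar>G b (t, y) - G b (t, y')\<bar> \<le> LF * norm ((t, y) - (t, y'))"
        using rF(3)[OF that(4)] TU[OF that(1,2)] TU[OF that(1,3)] unfolding Q_def by blast
      then show ?thesis by (simp add: norm_Pair)
    qed
    show "\<bar>G b (t, y)\<bar> \<le> M" if "t \<in> T" "y \<in> U" "b \<in> B" for t y b
    proof -
      have "\<bar>G b (t, y) - G b (t0, y0)\<bar> \<le> LF * norm ((t, y) - (t0, y0))"
        using rF(3)[OF that(3)] TU[OF that(1,2)] centre_in_ball[of "(t0, y0)" rF] rF(1)
        unfolding Q_def by blast
      also have "\<dots> \<le> LF * rF"
        using TU[OF that(1,2)] rF(2) unfolding mem_ball dist_norm norm_minus_commute[of "(t0, y0)"]
        by (intro mult_left_mono) linarith+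
      finally have "\<bar>G b (t, y)\<bar> \<le> \<bar>G b (t0, y0)\<bar> + LF * rF" by linarith
      moreover have "\<bar>G b (t0, y0)\<bar> \<le> (\<Sum>b\<in>B. \<bar>G b (t0, y0)\<bar>)"
        using that(3) finB by (intro member_le_sum) auto
      ultimately show ?thesis by (simp add: M_def)
    qed
  qed (use B \<open>r0 > 0\<close> rW(2) rF(2) \<open>M \<ge> 0\<close> in auto)
  show thesis
  proof (rule that[OF r(1,3)])
    show "ball y0 r \<subseteq> cod_of c" using r(2) Uc by (auto simp: U_def)
    show "norm (Z t y - Z t y') \<le> L * norm (y - y')"
      if "t \<in> {0..1}" "\<bar>t - t0\<bar> < r" "y \<in> ball y0 r" "y' \<in> ball y0 r" for t y y'
      using that r(2) by (intro r(4)) (auto simp: T_def r0_def)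
  qed
qed


section \<open>Uniqueness of integral curves\<close>

text \<open>On an interval of length less than \<open>1 / L\<close> the maximum of \<open>norm z\<close> is bounded by a proper
  fraction of itself.\<close>

lemma differential_inequality_zero:
  fixes z :: "real \<Rightarrow> 'e::real_normed_vector"
  assumes der: "\<And>s. s \<in> {a..b} \<Longrightarrow> (z has_vector_derivative z' s) (at s within {a..b})"
    and bound: "\<And>s. s \<in> {a..b} \<Longrightarrow> norm (z' s) \<le> L * norm (z s)"
    and "L \<ge> 0" "L * (b - a) < 1" and s0: "s0 \<in> {a..b}" "z s0 = 0" and s: "s \<in> {a..b}"
  shows "z s = 0"
proof -
  have "continuous_on {a..b} z"
    using der has_vector_derivative_continuous continuous_on_eq_continuous_within by blast
  then have "continuous_on {a..b} (\<lambda>s. norm (z s))" by (intro continuous_intros)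
  then obtain m where m: "m \<in> {a..b}" "\<And>s. s \<in> {a..b} \<Longrightarrow> norm (z s) \<le> norm (z m)"
    using continuous_attains_sup[of "{a..b}" "\<lambda>s. norm (z s)"] s0 by auto
  \<comment> \<open>As \<open>z\<close> vanishes at \<open>s0\<close>, the left side is the maximum
    itself.\<close>
  have "norm (z m - z s0) \<le> (L * norm (z m)) * norm (m - s0)"
  proof (rule differentiable_bound[OF convex_closed_interval])
    fix s assume s: "s \<in> {a..b}"
    show "(z has_derivative (\<lambda>h. h *\<^sub>R z' s)) (at s within {a..b})"
      using der[OF s] by (simp add: has_vector_derivative_def)
    have "norm (z' s) \<le> L * norm (z m)"
      using bound[OF s] m(2)[OF s] \<open>L \<ge> 0\<close> by (meson mult_left_mono order_trans)
    then show "onorm (\<lambda>h. h *\<^sub>R z' s) \<le> L * norm (z m)"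
      by (intro onorm_le) (simp add: mult.commute mult_left_mono)
  qed (use m s0 in auto)
  also have "\<dots> \<le> (L * norm (z m)) * (b - a)"
    using m(1) s0(1) \<open>L \<ge> 0\<close> by (intro mult_left_mono) auto
  finally have "norm (z m) \<le> L * (b - a) * norm (z m)"
    using s0 by (simp add: mult_ac)
  then have "(1 - L * (b - a)) * norm (z m) \<le> 0" by (simp add: algebra_simps)
  then have "norm (z m) \<le> 0"
    using \<open>L * (b - a) < 1\<close> by (simp add: mult_le_0_iff)
  then show ?thesis using m(2)[OF s] by simp
qed

lemma smooth_manifold_chart_at:
  assumes "smooth_manifold A" obtains c where "c \<in> charts_at A p"
proof -
  have "p \<in> (\<Union>c\<in>A. dom_of c)" using assms by (simp add: smooth_manifold_def)
  then show thesis using that by (auto simp: charts_at_def)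
qed

lemma continuous_curve_eventually:
  assumes "continuous_on I x" "s \<in> I" "open U" "x s \<in> U"
  obtains e where "e > 0" "\<And>s'. s' \<in> I \<Longrightarrow> dist s' s < e \<Longrightarrow> x s' \<in> U"
proof -
  have "(x \<longlongrightarrow> x s) (at s within I)" using assms by (simp add: continuous_on_def)
  then have "\<forall>\<^sub>F s' in at s within I. x s' \<in> U" using assms topological_tendstoD by blast
  then obtain e where "e > 0" "\<forall>s'\<in>I. s' \<noteq> s \<and> dist s' s < e \<longrightarrow> x s' \<in> U"
    unfolding eventually_at by blast
  then show thesis using that assms(4) by metis
qed

text \<open>For a short time both curves stay in one chart and in one Lipschitz ball, where their
  coordinate difference satisfies the differential inequality. Only the common value at
  \<open>s0\<close> matters, so the initial points may differ. The bound \<open>T \<le> 1\<close>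
  keeps all times in the range where \<open>H\<close> is smooth.\<close>

lemma hamiltonian_solution_unique_near:
  fixes A :: "('m::{t2_space,second_countable_topology}, 'e::real_inner) chart set"
  assumes S: "symplectic_manifold A \<omega>" and H: "smooth_time_function A H" and "T \<le> 1"
  defines "V \<equiv> \<lambda>t. hamiltonian_vector_field A \<omega> (H t)"
  assumes x: "is_solution A V T x0 x" and y: "is_solution A V T y0 y"
    and s0: "s0 \<in> {0..T}" "x s0 = y s0"
  shows "\<forall>\<^sub>F s in at s0 within {0..T}. x s = y s"
proof -
  have A: "smooth_manifold A" using S by (simp add: symplectic_manifold_def)
  obtain c where cq: "c \<in> charts_at A (x s0)" using smooth_manifold_chart_at[OF A] .
  then have c: "c \<in> A" "x s0 \<in> dom_of c" by (auto simp: charts_at_def)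
  note C = is_chartD[OF smooth_manifold_is_chart[OF A c(1)]]
  let ?y0 = "coord c (x s0)"
  have y0: "?y0 \<in> cod_of c" using c by simp
  have "s0 \<in> {0..1}" using s0 \<open>T \<le> 1\<close> by simp
  then obtain r L where r: "r > 0" "L \<ge> 0" "ball ?y0 r \<subseteq> cod_of c"
    "\<And>t y y'. t \<in> {0..1} \<Longrightarrow> \<bar>t - s0\<bar> < r \<Longrightarrow> y \<in> ball ?y0 r \<Longrightarrow> y' \<in> ball ?y0 r \<Longrightarrow>
       norm (V t (param c y) c - V t (param c y') c) \<le> L * norm (y - y')"
    using hamiltonian_vector_field_locally_lipschitz[OF S H c(1) y0] unfolding V_def by metis
  let ?U = "dom_of c \<inter> coord c -` ball ?y0 r"
  have U: "open ?U" "x s0 \<in> ?U"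
    using continuous_open_preimage[OF C(3) C(1) open_ball] c r(1) by auto
  have cx: "continuous_on {0..T} x" and cy: "continuous_on {0..T} y"
    using x y by (auto simp: is_solution_def smooth_curve_def)
  obtain e1 where e1: "e1 > 0" "\<And>s. s \<in> {0..T} \<Longrightarrow> dist s s0 < e1 \<Longrightarrow> x s \<in> ?U"
    using continuous_curve_eventually[OF cx s0(1) U] by metis
  obtain e2 where e2: "e2 > 0" "\<And>s. s \<in> {0..T} \<Longrightarrow> dist s s0 < e2 \<Longrightarrow> y s \<in> ?U"
    using continuous_curve_eventually[OF cy s0(1) U(1)] U(2) s0(2) by metis
  \<comment> \<open>The interval around \<open>s0\<close> has length at most \<open>2 * h\<close>,
    and the bound \<open>1 / (2 * (L + 1))\<close> makes \<open>L * (2 * h) < 1\<close>. The final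
    halving gives strict inequalities against \<open>e1\<close>, \<open>e2\<close> and
    \<open>r\<close>.\<close>
  define h where "h = min (min e1 e2) (min r (1 / (2 * (L + 1)))) / 2"
  have h: "h > 0" "h < e1" "h < e2" "h < r" "L * (2 * h) < 1"
  proof -
    have "L * (2 * h) \<le> L * (1 / (2 * (L + 1)))"
      using r(2) by (intro mult_left_mono) (auto simp: h_def)
    also have "\<dots> < 1" using r(2) by (simp add: divide_simps)
    finally show "L * (2 * h) < 1" .
  qed (use e1(1) e2(1) r(1,2) in \<open>auto simp: h_def min_def\<close>)
  \<comment> \<open>Clipping to \<open>{0..T}\<close> also covers the case that \<open>s0\<close> is
    an endpoint.\<close>
  define a where "a = max 0 (s0 - h)"
  define b where "b = min T (s0 + h)"
  have ab: "s \<in> {0..T}" "dist s s0 \<le> h" if "s \<in> {a..b}" for s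
    using that by (auto simp: a_def b_def dist_real_def)
  let ?z = "\<lambda>s. coord c (x s) - coord c (y s)"
  have "?z s = 0" if s: "s \<in> {a..b}" for s
  proof (rule differential_inequality_zero[where z = ?z and L = L and a = a and b = b and ?s0.0 = s0
          and z' = "\<lambda>s. V s (x s) c - V s (y s) c"])
    fix s assume s: "s \<in> {a..b}"
    have xs: "x s \<in> ?U" and ys: "y s \<in> ?U"
      using e1(2) e2(2) ab[OF s] h by auto
    have "c \<in> charts_at A (x s)" "c \<in> charts_at A (y s)"
      using xs ys c by (auto simp: charts_at_def)
    then have "((coord c \<circ> x) has_vector_derivative V s (x s) c) (at s within {0..T})"
      "((coord c \<circ> y) has_vector_derivative V s (y s) c) (at s within {0..T})"
      using x y ab[OF s] by (auto simp: is_solution_def)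
    then have "(?z has_vector_derivative V s (x s) c - V s (y s) c) (at s within {0..T})"
      unfolding o_def by (rule has_vector_derivative_diff)
    then show "(?z has_vector_derivative V s (x s) c - V s (y s) c) (at s within {a..b})"
      by (rule has_vector_derivative_within_subset) (use ab in auto)
    have "s \<in> {0..1}" "\<bar>s - s0\<bar> < r" using ab[OF s] h \<open>T \<le> 1\<close> by (auto simp: dist_real_def)
    from r(4)[OF this, of "coord c (x s)" "coord c (y s)"]
    show "norm (V s (x s) c - V s (y s) c) \<le> L * norm (?z s)"
      using xs ys C(5) by simp
  next
    have "L * (b - a) \<le> L * (2 * h)"
      using r(2) by (intro mult_left_mono) (auto simp: a_def b_def)
    then show "L * (b - a) < 1" using h by simp
  qed (use s s0 h r in \<open>auto simp: a_def b_def\<close>)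
  then have "x s = y s" if "s \<in> {a..b}" for s
  proof -
    have "coord c (x s) = coord c (y s)" using \<open>\<And>s. s \<in> {a..b} \<Longrightarrow> ?z s = 0\<close>[OF that] by simp
    moreover have "x s \<in> dom_of c" "y s \<in> dom_of c"
      using e1(2) e2(2) ab[OF that] h by auto
    ultimately show ?thesis using C(5) by metis
  qed
  then have "\<forall>s\<in>{0..T}. s \<noteq> s0 \<and> dist s s0 < h \<longrightarrow> x s = y s"
    by (simp add: a_def b_def dist_real_def abs_less_iff)
  then show ?thesis using h(1) unfolding eventually_at by blast
qed

text \<open>The set of times at which the curves agree is open by local uniqueness, its complement
  is open by the Hausdorff property, and the time interval is connected.\<close>

lemma hamiltonian_solution_unique:
  fixes A :: "('m::{t2_space,second_countable_topology}, 'e::real_inner) chart set"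
  assumes S: "symplectic_manifold A \<omega>" and H: "smooth_time_function A H" and "T \<le> 1"
  defines "V \<equiv> \<lambda>t. hamiltonian_vector_field A \<omega> (H t)"
  assumes x: "is_solution A V T x0 x" and y: "is_solution A V T x0 y" and s: "s \<in> {0..T}"
  shows "x s = y s"
proof -
  have cx: "continuous_on {0..T} x" and cy: "continuous_on {0..T} y"
    using x y by (auto simp: is_solution_def smooth_curve_def)
  have "(x s = y s) = (x 0 = y 0)"
  proof (rule connected_local_const[where A = "{0..T}" and f = "\<lambda>s. x s = y s"])
    show "\<forall>a\<in>{0..T}. \<forall>\<^sub>F b in at a within {0..T}. (x a = y a) = (x b = y b)"
    proof
      fix a assume a: "a \<in> {0..T}"
      show "\<forall>\<^sub>F b in at a within {0..T}. (x a = y a) = (x b = y b)"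
      proof (cases "x a = y a")
        case True
        then show ?thesis
          using hamiltonian_solution_unique_near[OF S H \<open>T \<le> 1\<close> x[unfolded V_def] y[unfolded V_def] a]
          by simp
      next
        case False
        then obtain U W where UW: "open U" "open W" "x a \<in> U" "y a \<in> W" "U \<inter> W = {}"
          using hausdorff by metis
        have "\<forall>\<^sub>F b in at a within {0..T}. x b \<in> U" "\<forall>\<^sub>F b in at a within {0..T}. y b \<in> W"
          using cx cy a UW by (auto simp: continuous_on_def intro: topological_tendstoD)
        then show ?thesis
          by eventually_elim (use False UW in auto)
      qed
    qed
  qed (use s in auto)
  then show ?thesis using x y by (simp add: is_solution_def)
qed

text \<open>\<open>flow\<close> at time \<open>t\<close> refers to solutions on
  \<open>{0..t}\<close>, whereas compatibility supplies solutions on \<open>{0..1}\<close>.\<close>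

lemma is_solution_restrict:
  assumes "is_solution A V T x0 x" "t \<le> T"
  shows "is_solution A V t x0 x"
proof -
  have sub: "{0..t} \<subseteq> {0..T}" using assms by auto
  have "smooth_on {s \<in> {0..t}. x s \<in> dom_of c} (coord c \<circ> x)" if "c \<in> A" for c
  proof (rule smooth_on_subset)
    show "smooth_on {s \<in> {0..T}. x s \<in> dom_of c} (coord c \<circ> x)"
      using assms(1) that unfolding is_solution_def smooth_curve_def by blast
  qed (use sub in auto)
  moreover have "continuous_on {0..t} x"
    using assms(1) by (intro continuous_on_subset[OF _ sub]) (simp add: is_solution_def smooth_curve_def)
  moreover have "((coord c \<circ> x) has_vector_derivative V s (x s) c) (at s within {0..t})"
    if "s \<in> {0..t}" "c \<in> charts_at A (x s)" for s c
    using assms that sub unfolding is_solution_def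
    by (intro has_vector_derivative_within_subset[OF _ sub]) auto
  ultimately show ?thesis
    using assms unfolding is_solution_def smooth_curve_def by blast
qed

lemma hamiltonian_flow_eq:
  fixes A :: "('m::{t2_space,second_countable_topology}, 'e::real_inner) chart set"
  assumes S: "symplectic_manifold A \<omega>" and H: "smooth_time_function A H"
  defines "V \<equiv> \<lambda>t. hamiltonian_vector_field A \<omega> (H t)"
  assumes x: "is_solution A V 1 x0 x" and t: "t \<in> {0..1}"
  shows "flow A V t x0 = x t"
  unfolding flow_def
proof (rule the_equality)
  have xt: "is_solution A V t x0 x" using is_solution_restrict[OF x] t by auto
  then show "\<exists>x'. is_solution A V t x0 x' \<and> x t = x' t" by blast
  show "z = x t" if "\<exists>x'. is_solution A V t x0 x' \<and> z = x' t" for z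
    using that hamiltonian_solution_unique[OF S H _ _ xt[unfolded V_def]] t
    unfolding V_def by fastforce
qed

lemma compatible_hamiltonian_trajectory:
  fixes A :: "('m::{t2_space,second_countable_topology}, 'e::real_inner) chart set"
  assumes S: "symplectic_manifold A \<omega>" and H: "H \<in> compatible_hamiltonians A \<omega> X"
    and "p \<in> X" "t \<in> {0..1}"
  obtains x0 x where "is_solution A (\<lambda>t. hamiltonian_vector_field A \<omega> (H t)) 1 x0 x"
    "x t = p" "\<And>s. s \<in> {0..1} \<Longrightarrow> x s \<in> X"
proof -
  let ?V = "\<lambda>t. hamiltonian_vector_field A \<omega> (H t)"
  have H': "smooth_time_function A H" and comp: "compatible A X ?V"
    using H by (auto simp: compatible_hamiltonians_def)
  have fl: "flow A ?V s ` X = X" if "s \<in> {0..1}" for s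
    using comp that by (simp add: compatible_def)
  have "p \<in> flow A ?V t ` X" using fl[OF assms(4)] assms(3) by simp
  then obtain x0 where x0: "x0 \<in> X" "p = flow A ?V t x0" by blast
  have "x0 \<in> flow_domain A ?V 1" using comp x0 unfolding compatible_def by blast
  then obtain x where x: "is_solution A ?V 1 x0 x" unfolding flow_domain_def by blast
  have fx: "flow A ?V s x0 = x s" if "s \<in> {0..1}" for s
    by (rule hamiltonian_flow_eq[OF S H' x that])
  show thesis
  proof (rule that[OF x])
    show "x t = p" using fx[OF assms(4)] x0 by simp
    show "x s \<in> X" if "s \<in> {0..1}" for s
      using fx[OF that] fl[OF that] x0(1) by (metis imageI)
  qed
qed


section \<open>Constancy on isotropic submanifolds\<close>

text \<open>The orthogonal projection \<open>P\<close> onto \<open>S\<close> is bounded linear and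
  fixes \<open>f\<close> near \<open>t\<close>, so \<open>D\<close> and \<open>P D\<close> are both
  derivatives of \<open>f\<close>. Derivatives within \<open>{0..1}\<close> are unique at the
  endpoints too.\<close>

lemma vector_derivative_in_subspace:
  fixes f :: "real \<Rightarrow> 'e::real_inner"
  assumes B: "onb_of S B" and der: "(f has_vector_derivative D) (at t within {0..1})"
    and t: "t \<in> {0..1}" and e: "e > 0" "\<And>s. s \<in> {0..1} \<Longrightarrow> dist s t < e \<Longrightarrow> f s \<in> S"
  shows "D \<in> S"
proof -
  define P where "P v = (\<Sum>b\<in>B. (v \<bullet> b) *\<^sub>R b)" for v :: 'e
  have "bounded_linear P"
    unfolding P_def by (intro bounded_linear_sum bounded_linear_scaleR_const bounded_linear_inner_left)
  then have "((\<lambda>s. P (f s)) has_vector_derivative P D) (at t within {0..1})"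
    using bounded_linear.has_vector_derivative[OF _ der] by blast
  then have "(f has_vector_derivative P D) (at t within {0..1})"
  proof (rule has_vector_derivative_transform_within[OF _ e(1) t])
    show "P (f s) = f s" if "s \<in> {0..1}" "dist s t < e" for s
      unfolding P_def by (rule onb_of_expansion[OF B e(2)[OF that]])
  qed
  then have "D = P D"
    using vector_derivative_unique_within_closed_interval[of 0 1 t f D "P D"] der t by simp
  also have "P D \<in> span B"
    unfolding P_def by (intro span_sum span_scale span_base)
  finally show ?thesis using B by (simp add: onb_of_def)
qed

lemma hamiltonian_vector_field_tangent:
  fixes A :: "('m::{t2_space,second_countable_topology}, 'e::real_inner) chart set"
  assumes S: "symplectic_manifold A \<omega>" and H: "H \<in> compatible_hamiltonians A \<omega> X"
    and p: "p \<in> X" and t: "t \<in> {0..1}" and c: "slice_chart A X c S'" "p \<in> dom_of c"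
  shows "hamiltonian_vector_field A \<omega> (H t) p c \<in> S'"
proof -
  have A: "smooth_manifold A" using S by (simp add: symplectic_manifold_def)
  have c': "c \<in> A" "subspace S'" "coord c ` (dom_of c \<inter> X) = cod_of c \<inter> S'"
    using c(1) by (auto simp: slice_chart_def)
  obtain B where B: "onb_of S' B" using smooth_manifold_onb_of[OF A c'(2)] .
  obtain x0 x where x: "is_solution A (\<lambda>t. hamiltonian_vector_field A \<omega> (H t)) 1 x0 x"
    "x t = p" "\<And>s. s \<in> {0..1} \<Longrightarrow> x s \<in> X"
    using compatible_hamiltonian_trajectory[OF S H p t] by metis
  have cx: "continuous_on {0..1} x"
    using x(1) by (simp add: is_solution_def smooth_curve_def)
  have "x t \<in> dom_of c" using x(2) c(2) by simp
  \<comment> \<open>Continuity keeps the curve in the slice chart for times near \<open>t\<close>,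
    where lying in \<open>X\<close> means having coordinates in \<open>S'\<close>.\<close>
  then obtain e where e: "e > 0" "\<And>s. s \<in> {0..1} \<Longrightarrow> dist s t < e \<Longrightarrow> x s \<in> dom_of c"
    using continuous_curve_eventually[OF cx t is_chartD(1)[OF smooth_manifold_is_chart[OF A c'(1)]]]
    by metis
  have "c \<in> charts_at A (x t)" using c'(1) c(2) x(2) by (simp add: charts_at_def)
  then have "((coord c \<circ> x) has_vector_derivative hamiltonian_vector_field A \<omega> (H t) (x t) c)
      (at t within {0..1})"
    using x(1) t unfolding is_solution_def by blast
  then have "hamiltonian_vector_field A \<omega> (H t) (x t) c \<in> S'"
  proof (rule vector_derivative_in_subspace[OF B _ t e(1)])
    show "(coord c \<circ> x) s \<in> S'" if "s \<in> {0..1}" "dist s t < e" for s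
      using e(2)[OF that] x(3)[OF that(1)] c'(3) by auto
  qed
  then show ?thesis using x(2) by simp
qed

text \<open>In a slice chart \<open>X\<close> is a linear subspace, any two points of which in a
  ball are joined by a segment inside both. The derivative of \<open>H t\<close> along that segment
  is zero.\<close>

lemma hamiltonian_locally_constant:
  fixes A :: "('m::{t2_space,second_countable_topology}, 'e::real_inner) chart set"
  assumes S: "symplectic_manifold A \<omega>" and H: "H \<in> compatible_hamiltonians A \<omega> X"
    and X: "submanifold A X" "isotropic A \<omega> X" and p: "p \<in> X" and t: "t \<in> {0..1}"
  shows "\<forall>\<^sub>F q in at p within X. H t p = H t q"
proof -
  have A: "smooth_manifold A" using S by (simp add: symplectic_manifold_def)
  have H': "smooth_time_function A H" using H by (simp add: compatible_hamiltonians_def)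
  obtain c S' where c: "slice_chart A X c S'" "p \<in> dom_of c"
    using X(1) p unfolding submanifold_def by blast
  then have c': "c \<in> A" "subspace S'" "coord c ` (dom_of c \<inter> X) = cod_of c \<inter> S'"
    by (auto simp: slice_chart_def)
  note C = is_chartD[OF smooth_manifold_is_chart[OF A c'(1)]]
  let ?F = "H t \<circ> param c"
  have diff: "?F differentiable (at y)" if "y \<in> cod_of c" for y
    by (rule smooth_time_function_differentiable[OF A H' c'(1) that t])
  \<comment> \<open>This is needed at every point of the slice, not only at \<open>p\<close>, since
    the segment runs through other points of \<open>X\<close>.\<close>
  have zero: "frechet_derivative ?F (at y) a = 0" if y: "y \<in> cod_of c" "y \<in> S'" and a: "a \<in> S'" for y a
  proof -
    let ?q = "param c y"
    have "y \<in> coord c ` (dom_of c \<inter> X)" using y c'(3) by blast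
    then have q: "?q \<in> X" "?q \<in> dom_of c" using C(5) by auto
    let ?u = "hamiltonian_vector_field A \<omega> (H t) ?q"
    have cq: "c \<in> charts_at A ?q" by (rule charts_at_param[OF A c'(1) y(1)])
    note u = hamiltonian_vector_field_works[OF S c'(1) y(1) diff[OF y(1)]]
    have "?u \<in> submanifold_tangent_space A X ?q"
      using u(1) hamiltonian_vector_field_tangent[OF S H q(1) t c(1) q(2)] c(1) q(2)
      unfolding submanifold_tangent_space_def by blast
    moreover have "coord_vector A c ?q a \<in> submanifold_tangent_space A X ?q"
      using coord_vector_in_tangent_space[OF A cq] coord_vector_self[OF A cq] a c(1) q(2)
      unfolding submanifold_tangent_space_def by (metis (mono_tags, lifting) mem_Collect_eq)
    ultimately show ?thesis
      using X(2) q(1) u(2) unfolding isotropic_def by metis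
  qed
  let ?y0 = "coord c p"
  have y0: "?y0 \<in> cod_of c" "?y0 \<in> S'" using c(2) p c'(3) by blast+
  obtain r where r: "r > 0" "ball ?y0 r \<subseteq> cod_of c"
    using C(2) y0(1) openE by blast
  have const: "?F y = ?F ?y0" if y: "y \<in> ball ?y0 r" "y \<in> S'" for y
  proof -
    \<comment> \<open>The segment stays in the ball by convexity and in \<open>S'\<close> by
      linearity.\<close>
    let ?l = "\<lambda>s. ?y0 + s *\<^sub>R (y - ?y0)"
    have l: "?l s \<in> cod_of c" "?l s \<in> S'" if "s \<in> {0..1}" for s
    proof -
      have "?l s = (1 - s) *\<^sub>R ?y0 + s *\<^sub>R y" by (simp add: algebra_simps)
      also have "\<dots> \<in> ball ?y0 r"
        using that y r(1) by (intro convexD[OF convex_ball]) auto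
      finally show "?l s \<in> cod_of c" using r(2) by blast
      show "?l s \<in> S'"
        using y0(2) y(2) c'(2) by (simp add: subspace_add subspace_scale subspace_diff)
    qed
    have "(?F \<circ> ?l) 1 = (?F \<circ> ?l) 0"
    proof (rule has_derivative_zero_unique[where s = "{0..1}" and f = "?F \<circ> ?l"])
      fix s :: real assume s: "s \<in> {0..1}"
      let ?D = "frechet_derivative ?F (at (?l s))"
      have "(?F has_derivative ?D) (at (?l s))"
        using diff[OF l(1)[OF s]] by (simp flip: frechet_derivative_works)
      moreover have "(?l has_derivative (\<lambda>h. h *\<^sub>R (y - ?y0))) (at s)"
        by (auto intro!: derivative_eq_intros)
      ultimately have "((?F \<circ> ?l) has_derivative (?D \<circ> (\<lambda>h. h *\<^sub>R (y - ?y0)))) (at s)"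
        by (intro diff_chain_at)
      moreover have "?D \<circ> (\<lambda>h. h *\<^sub>R (y - ?y0)) = (\<lambda>h. 0)"
        using zero[OF l[OF s]] y(2) y0(2) c'(2) by (simp add: fun_eq_iff subspace_scale subspace_diff)
      ultimately show "((?F \<circ> ?l) has_derivative (\<lambda>h. 0)) (at s within {0..1})"
        by (simp add: has_derivative_at_withinI)
    qed auto
    then show ?thesis by simp
  qed
  let ?U = "dom_of c \<inter> coord c -` ball ?y0 r"
  have "open ?U" "p \<in> ?U"
    using continuous_open_preimage[OF C(3) C(1) open_ball] c r(1) by auto
  moreover have "H t p = H t q" if q: "q \<in> ?U" "q \<in> X" for q
  proof -
    have "coord c q \<in> S'" using q c'(3) by blast
    then have "?F (coord c q) = ?F ?y0" using const q by simp
    then show ?thesis using C(5) q c(2) by simp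
  qed
  ultimately show ?thesis
    unfolding eventually_at_topological by blast
qed

theorem proposition3:
  fixes A :: "('m::{t2_space,second_countable_topology}, 'e::real_inner) chart set"
    and \<omega> :: "('m, 'e) two_form"
    and X :: "'m set"
    and H :: "real \<Rightarrow> 'm \<Rightarrow> real"
  assumes "symplectic_manifold A \<omega>"
    and "closed X"
    and "submanifold A X"
    and "connected X"
    and "isotropic A \<omega> X"
    and "H \<in> compatible_hamiltonians A \<omega> X"
  shows "hofer_norm X H = 0"
proof -
  have const: "H t p = H t q" if "t \<in> {0..1}" "p \<in> X" "q \<in> X" for t p q
    using connected_local_const[OF assms(4) that(2,3), of "H t"]
      hamiltonian_locally_constant[OF assms(1,6,3,5) _ that(1)] by blast
  have "e2ennreal ((SUP x\<in>X. ereal (H t x)) - (INF x\<in>X. ereal (H t x))) = 0" if t: "t \<in> {0..1}" for t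
  proof (cases "X = {}")
    case True
    then show ?thesis by (simp add: bot_ereal_def top_ereal_def e2ennreal_neg)
  next
    case False
    then obtain p where p: "p \<in> X" by blast
    \<comment> \<open>Supremum and infimum are the same finite number, so their difference is 0 and
      not a difference of infinities.\<close>
    have "(\<lambda>x. ereal (H t x)) ` X = {ereal (H t p)}"
      using const[OF t _ p] p by blast
    then show ?thesis by (simp add: zero_ereal_def[symmetric] e2ennreal_neg)
  qed
  then have "hofer_norm X H = (\<integral>\<^sup>+ (t::real). 0 \<partial>lborel)"
    unfolding hofer_norm_def by (intro nn_integral_cong) (auto simp: indicator_def)
  then show ?thesis by simp
qed

end
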